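(* Let $\{W(k)\}$ be an independent random model of $m\times m$ stochastic matrices which is an $\ell_1$-approximation of an independent random model that has a common steady state $\pi>0$ in expectation and weak feedback property. Let $\bar W(k)=\mathsf{E}[W(k)]$, let $G^{\infty}$ be the infinite flow graph of $\{W(k)\}$ and let $\bar G^{\infty}$ be the infinite flow graph of the expected (deterministic) model $\{\bar W(k)\}$. Then $\{W(k)\}$ is stable almost surely and, for any $i,j\in[m]$, the following statements are equivalent: (a) $i\Leftrightarrow_W j$ (i.e. $i$ and $j$ are mutually ergodic indices for $\{W(k)\}$). (b) $i\Leftrightarrow_{\bar W} j$ (i.e. $i$ and $j$ are mutually ergodic indices for $\{\bar W(k)\}$). (c) $i$ and $j$ belong to the same connected component of $\bar G^{\infty}$. (d) $i$ and $j$ belong to the same connected component of $G^{\infty}$.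
   Context: $[m]=\{1,\dots,m\}$. A (row-)stochastic matrix is a nonnegative matrix whose rows each sum to $1$. A random model (random chain) $\{W(k)\}_{k\ge0}$ is a sequence of random $m\times m$ stochastic matrices on a probability space; it is independent if the matrices $W(k)$, $k\ge 0$, are independent. A deterministic chain is a sequence of deterministic stochastic matrices, viewed as a special independent random model. $W^i$ denotes the $i$th column of $W$. $\ell_1$-approximation: a random chain $\{U(k)\}$ is an $\ell_1$-approximation of a random chain $\{V(k)\}$ if $\sum_{k=0}^\infty |V_{ij}(k)-U_{ij}(k)|<\infty$ almost surely for all $i,j\in[m]$. A model $\{V(k)\}$ has a common steady state $\pi$ in expectation if $\pi^T\mathsf{E}[V(k)]=\pi^T$ for all $k\ge0$; $\pi>0$ means all entries are positive. It has weak feedback property if there is $\gamma>0$ with $\mathsf{E}[V^i(k)^TV^j(k)]\ge\gamma(\mathsf{E}[V_{ij}(k)]+\mathsf{E}[V_{ji}(k)])$ for all $k\ge0$ and all $i\ne j$ in $[m]$. Infinite flow graph of a model $\{W(k)\}$: the simple undirected graph on vertex set $[m]$ in which $\{i,j\}$, $i\neq j$, is an edge if and only if $\sum_{k=0}^\infty (W_{ij}(k)+W_{ji}(k))=\infty$ almost surely. Connected components are maximal. For a deterministic chain $\{A(k)\}$, consider the dynamics $x(k+1)=A(k)x(k)$, $k\ge t_0$. Indices $i,j$ are mutually weakly ergodic if $\lim_{k\to\infty}(x_i(k)-x_j(k))=0$ for every $t_0\ge0$ and every $x(t_0)\in\mathbb{R}^m$. An index $i$ is ergodic if $\lim_{k\to\infty}x_i(k)$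 exists for every $t_0\ge0$ and every $x(t_0)\in\mathbb{R}^m$. The chain is stable if every $i\in[m]$ is an ergodic index. Indices $i,j$ are mutually ergodic, written $i\Leftrightarrow_A j$, if both are ergodic indices and they are mutually weakly ergodic. A random model has one of these properties if it holds almost surely (for almost every realization of the chain). *)

theory Defs
  imports "HOL-Probability.Probability"
begin

(* The index set {1,...,m} is an arbitrary finite type 'n, so A $ i is the i-th row of A. *)

definition stochastic_matrix :: "real ^ 'n ^ 'n \<Rightarrow> bool" where
  "stochastic_matrix A \<longleftrightarrow> (\<forall>i j. 0 \<le> A $ i $ j) \<and> (\<forall>i. (\<Sum>j\<in>UNIV. A $ i $ j) = 1)"

definition random_model :: "'a measure \<Rightarrow> (nat \<Rightarrow> 'a \<Rightarrow> real ^ 'n ^ 'n) \<Rightarrow> bool" where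
  "random_model M W \<longleftrightarrow>
     prob_space M \<and>
     (\<forall>k. W k \<in> borel_measurable M) \<and>
     (\<forall>k. \<forall>\<omega>\<in>space M. stochastic_matrix (W k \<omega>))"

definition independent_model :: "'a measure \<Rightarrow> (nat \<Rightarrow> 'a \<Rightarrow> real ^ 'n ^ 'n) \<Rightarrow> bool" where
  "independent_model M W \<longleftrightarrow>
     random_model M W \<and> prob_space.indep_vars M (\<lambda>_. borel) W UNIV"

definition expected_chain :: "'a measure \<Rightarrow> (nat \<Rightarrow> 'a \<Rightarrow> real ^ 'n ^ 'n) \<Rightarrow> nat \<Rightarrow> real ^ 'n ^ 'n" where
  "expected_chain M W k = (\<integral>\<omega>. W k \<omega> \<partial>M)"

definition l1_approximation ::
    "'a measure \<Rightarrow> (nat \<Rightarrow> 'a \<Rightarrow> real ^ 'n ^ 'n) \<Rightarrow> (nat \<Rightarrow> 'a \<Rightarrow> real ^ 'n ^ 'n) \<Rightarrow> bool" where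
  "l1_approximation M U V \<longleftrightarrow>
     (\<forall>i j. AE \<omega> in M. summable (\<lambda>k. \<bar>V k \<omega> $ i $ j - U k \<omega> $ i $ j\<bar>))"

definition common_steady_state ::
    "'a measure \<Rightarrow> (nat \<Rightarrow> 'a \<Rightarrow> real ^ 'n ^ 'n) \<Rightarrow> real ^ 'n \<Rightarrow> bool" where
  "common_steady_state M V \<pi> \<longleftrightarrow> (\<forall>k. \<pi> v* expected_chain M V k = \<pi>)"

definition weak_feedback :: "'a measure \<Rightarrow> (nat \<Rightarrow> 'a \<Rightarrow> real ^ 'n ^ 'n) \<Rightarrow> bool" where
  "weak_feedback M V \<longleftrightarrow>
     (\<exists>\<gamma>>0. \<forall>k i j. i \<noteq> j \<longrightarrow>
        (\<integral>\<omega>. column i (V k \<omega>) \<bullet> column j (V k \<omega>) \<partial>M)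
          \<ge> \<gamma> * ((\<integral>\<omega>. V k \<omega> $ i $ j \<partial>M) + (\<integral>\<omega>. V k \<omega> $ j $ i \<partial>M)))"

(* Edges of a simple undirected graph are two-element sets of vertices. *)

definition infinite_flow_graph :: "'a measure \<Rightarrow> (nat \<Rightarrow> 'a \<Rightarrow> real ^ 'n ^ 'n) \<Rightarrow> 'n set set" where
  "infinite_flow_graph M W =
     {{i, j} | i j. i \<noteq> j \<and>
        (AE \<omega> in M. (\<Sum>k. ennreal (W k \<omega> $ i $ j + W k \<omega> $ j $ i)) = \<infinity>)}"

definition connected_vertices :: "'v set set \<Rightarrow> 'v set \<Rightarrow> bool" where
  "connected_vertices E C \<longleftrightarrow>
     C \<noteq> {} \<and> (\<forall>u\<in>C. \<forall>v\<in>C. (\<lambda>x y. x \<in> C \<and> y \<in> C \<and> {x, y} \<in> E)\<^sup>*\<^sup>* u v)"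

(* The vertex set is the whole type 'v, so isolated vertices are components too. *)

definition connected_component_of_graph :: "'v set set \<Rightarrow> 'v set \<Rightarrow> bool" where
  "connected_component_of_graph E C \<longleftrightarrow>
     connected_vertices E C \<and> (\<forall>D. connected_vertices E D \<and> C \<subseteq> D \<longrightarrow> D = C)"

definition same_connected_component :: "'v set set \<Rightarrow> 'v \<Rightarrow> 'v \<Rightarrow> bool" where
  "same_connected_component E i j \<longleftrightarrow>
     (\<exists>C. connected_component_of_graph E C \<and> i \<in> C \<and> j \<in> C)"

(* The values of x before time t0 are unconstrained and play no role below, since only
   limits are considered; x t0 ranges over all vectors. *)

definition dynamics :: "(nat \<Rightarrow> real ^ 'n ^ 'n) \<Rightarrow> nat \<Rightarrow> (nat \<Rightarrow> real ^ 'n) \<Rightarrow> bool" where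
  "dynamics A t0 x \<longleftrightarrow> (\<forall>k\<ge>t0. x (Suc k) = A k *v x k)"

definition mutually_weakly_ergodic :: "(nat \<Rightarrow> real ^ 'n ^ 'n) \<Rightarrow> 'n \<Rightarrow> 'n \<Rightarrow> bool" where
  "mutually_weakly_ergodic A i j \<longleftrightarrow>
     (\<forall>t0 x. dynamics A t0 x \<longrightarrow> (\<lambda>k. x k $ i - x k $ j) \<longlonglongrightarrow> 0)"

definition ergodic_index :: "(nat \<Rightarrow> real ^ 'n ^ 'n) \<Rightarrow> 'n \<Rightarrow> bool" where
  "ergodic_index A i \<longleftrightarrow> (\<forall>t0 x. dynamics A t0 x \<longrightarrow> convergent (\<lambda>k. x k $ i))"

definition stable_chain :: "(nat \<Rightarrow> real ^ 'n ^ 'n) \<Rightarrow> bool" where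
  "stable_chain A \<longleftrightarrow> (\<forall>i. ergodic_index A i)"

definition mutually_ergodic :: "(nat \<Rightarrow> real ^ 'n ^ 'n) \<Rightarrow> 'n \<Rightarrow> 'n \<Rightarrow> bool" where
  "mutually_ergodic A i j \<longleftrightarrow>
     ergodic_index A i \<and> ergodic_index A j \<and> mutually_weakly_ergodic A i j"

end

theory Submission
  imports Defs "HOL-Computational_Algebra.Polynomial"
begin

text \<open>
  Let \<open>x\<close> be a column of the products \<open>V (s + k - 1) \<cdots> V s\<close>. By Jensen's inequality and the common
  steady state, \<open>\<Sum>i. \<pi> i * x i ^ p\<close> is a bounded supermartingale for every \<open>p\<close>, hence converges
  almost surely. For \<open>p = 2\<close> the weak feedback property bounds its expected decrease from below by a
  multiple of \<open>E [(V ij + V ji) * (x i - x j)^2]\<close>, so these terms are summable and the increments of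
  \<open>x\<close> vanish. Together this makes every \<open>x i\<close> converge, with equal limits along edges of infinite
  flow. Both conclusions pass to \<open>W\<close> pathwise, as \<open>l1\<close> perturbations change trajectories arbitrarily
  little after a late start.

  The chains \<open>W\<close> and \<open>V\<close> need not be jointly independent, so the expected chain of \<open>W\<close> may fail to be
  an \<open>l1\<close>-approximation of that of \<open>V\<close>. Mutual ergodicity of the expected chain of \<open>W\<close> is instead
  obtained from that of \<open>W\<close> by dominated convergence, since by independence the expectation of a
  product is the product of the expectations. Conversely, a cut with summable flow keeps the
  trajectory of an indicator vector close to its start, and a Borel-Cantelli argument for \<open>W\<close> shows
  that both infinite flow graphs coincide.
\<close>

subsection \<open>Connected components\<close>

text \<open>The class of all vertices reachable from \<open>i\<close> is itself a component:
  reachability is symmetric because edges are unordered pairs, and a connected superset contains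
  \<open>i\<close> and hence only vertices reachable from it.\<close>

lemma same_connected_component_iff_rtranclp:
  "same_connected_component E i j \<longleftrightarrow> (\<lambda>x y. {x, y} \<in> E)\<^sup>*\<^sup>* i j"
proof
  assume "same_connected_component E i j"
  then obtain C where "(\<lambda>x y. x \<in> C \<and> y \<in> C \<and> {x, y} \<in> E)\<^sup>*\<^sup>* i j"
    unfolding same_connected_component_def connected_component_of_graph_def connected_vertices_def
    by blast
  then show "(\<lambda>x y. {x, y} \<in> E)\<^sup>*\<^sup>* i j"
    by (rule rtranclp_mono[THEN predicate2D, rotated]) auto
next
  let ?R = "\<lambda>x y. {x, y} \<in> E"
  assume ij: "?R\<^sup>*\<^sup>* i j"
  have sym: "?R\<^sup>*\<^sup>* v u" if "?R\<^sup>*\<^sup>* u v" for u v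
    using that
  proof induction
    case (step y z)
    then have "?R z y" by (simp add: insert_commute)
    then show ?case using step(3) by (rule converse_rtranclp_into_rtranclp)
  qed simp
  define C where "C = {v. ?R\<^sup>*\<^sup>* i v}"
  \<comment> \<open>A walk started inside \<open>C\<close> never leaves it, so it is also a walk of
    the relation restricted to \<open>C\<close>.\<close>
  have path: "(\<lambda>x y. x \<in> C \<and> y \<in> C \<and> {x, y} \<in> E)\<^sup>*\<^sup>* u v" if "u \<in> C" "?R\<^sup>*\<^sup>* u v" for u v
    using that(2)
  proof induction
    case base
    then show ?case by simp
  next
    case (step y z)
    have "y \<in> C" "z \<in> C"
      using that(1) step unfolding C_def by (auto intro: rtranclp_trans rtranclp.rtrancl_into_rtrancl)
    then show ?case
      using step by (auto intro: rtranclp.rtrancl_into_rtrancl)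
  qed
  have "connected_vertices E C"
    unfolding connected_vertices_def
  proof (intro conjI ballI)
    show "C \<noteq> {}"
      unfolding C_def by blast
    fix u v assume "u \<in> C" "v \<in> C"
    then have "?R\<^sup>*\<^sup>* u v"
      unfolding C_def using sym by (blast intro: rtranclp_trans)
    with \<open>u \<in> C\<close> show "(\<lambda>x y. x \<in> C \<and> y \<in> C \<and> {x, y} \<in> E)\<^sup>*\<^sup>* u v"
      by (rule path)
  qed
  moreover have "D = C" if D: "connected_vertices E D" "C \<subseteq> D" for D
  proof -
    have "i \<in> D"
      using D(2) unfolding C_def by auto
    have "v \<in> C" if "v \<in> D" for v
    proof -
      have "(\<lambda>x y. x \<in> D \<and> y \<in> D \<and> {x, y} \<in> E)\<^sup>*\<^sup>* i v"
        using D(1) \<open>i \<in> D\<close> that unfolding connected_vertices_def by blast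
      then have "?R\<^sup>*\<^sup>* i v"
        by (rule rtranclp_mono[THEN predicate2D, rotated]) auto
      then show ?thesis
        unfolding C_def by simp
    qed
    with D(2) show ?thesis by blast
  qed
  ultimately show "same_connected_component E i j"
    unfolding same_connected_component_def connected_component_of_graph_def
    using ij by (intro exI[of _ C]) (auto simp: C_def)
qed

subsection \<open>Deterministic chains\<close>

lemma stochastic_matrixD:
  assumes "stochastic_matrix A"
  shows "0 \<le> A $ i $ j" "(\<Sum>j\<in>UNIV. A $ i $ j) = 1" "A $ i $ j \<le> 1"
proof -
  show nonneg: "0 \<le> A $ i $ j" for i j
    using assms unfolding stochastic_matrix_def by blast
  show sum: "(\<Sum>j\<in>UNIV. A $ i $ j) = 1"
    using assms unfolding stochastic_matrix_def by blast
  show "A $ i $ j \<le> 1"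
    using member_le_sum[of j UNIV "\<lambda>j. A $ i $ j"] nonneg sum by simp
qed

lemma stochastic_matrix_mult:
  fixes A B :: "real ^ 'n ^ 'n"
  assumes "stochastic_matrix A" "stochastic_matrix B"
  shows "stochastic_matrix (A ** B)"
proof -
  have "(\<Sum>j\<in>UNIV. (A ** B) $ i $ j) = 1" for i
  proof -
    have "(\<Sum>j\<in>UNIV. (A ** B) $ i $ j) = (\<Sum>k\<in>UNIV. A $ i $ k * (\<Sum>j\<in>UNIV. B $ k $ j))"
      by (simp add: matrix_matrix_mult_def sum_distrib_left) (rule sum.swap)
    then show ?thesis
      by (simp add: stochastic_matrixD(2)[OF assms(1)] stochastic_matrixD(2)[OF assms(2)])
  qed
  moreover have "0 \<le> (A ** B) $ i $ j" for i j
    by (simp add: matrix_matrix_mult_def sum_nonneg stochastic_matrixD(1)[OF assms(1)]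
        stochastic_matrixD(1)[OF assms(2)])
  ultimately show ?thesis
    unfolding stochastic_matrix_def by blast
qed

lemma stochastic_matrix_one: "stochastic_matrix (mat 1 :: real ^ 'n ^ 'n)"
  unfolding stochastic_matrix_def mat_def by simp

text \<open>Split \<open>A x - B y\<close> as \<open>A (x - y) + (A - B) y\<close>. Averaging by a
  row of \<open>A\<close> does not increase the error \<open>e\<close>, and the entries of
  \<open>y\<close> are bounded by one. Summing over all rows instead of row \<open>i\<close> alone
  makes the bound independent of \<open>i\<close>, so that it can be iterated over time.\<close>

lemma stochastic_matrix_diff_mult_vec_le:
  fixes A B :: "real ^ 'n ^ 'n"
  assumes A: "stochastic_matrix A" and xy: "\<And>j. \<bar>x $ j - y $ j\<bar> \<le> e" and y: "\<And>j. \<bar>y $ j\<bar> \<le> 1"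
  shows "\<bar>(A *v x) $ i - (B *v y) $ i\<bar> \<le> e + (\<Sum>i\<in>UNIV. \<Sum>j\<in>UNIV. \<bar>A $ i $ j - B $ i $ j\<bar>)"
proof -
  have "(A *v x) $ i - (B *v y) $ i
      = (\<Sum>j\<in>UNIV. A $ i $ j * (x $ j - y $ j) + (A $ i $ j - B $ i $ j) * y $ j)"
    unfolding matrix_vector_mult_def by (simp add: sum_subtractf[symmetric] algebra_simps)
  then have "\<bar>(A *v x) $ i - (B *v y) $ i\<bar>
      \<le> (\<Sum>j\<in>UNIV. \<bar>A $ i $ j * (x $ j - y $ j) + (A $ i $ j - B $ i $ j) * y $ j\<bar>)"
    by simp
  also have "\<dots> \<le> (\<Sum>j\<in>UNIV. A $ i $ j * e + \<bar>A $ i $ j - B $ i $ j\<bar>)"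
  proof (rule sum_mono)
    fix j
    have "\<bar>A $ i $ j * (x $ j - y $ j)\<bar> \<le> A $ i $ j * e"
      using xy[of j] stochastic_matrixD(1)[OF A, of i j] by (simp add: abs_mult mult_left_mono)
    moreover have "\<bar>(A $ i $ j - B $ i $ j) * y $ j\<bar> \<le> \<bar>A $ i $ j - B $ i $ j\<bar>"
      using y[of j] by (simp add: abs_mult mult_left_le)
    ultimately show "\<bar>A $ i $ j * (x $ j - y $ j) + (A $ i $ j - B $ i $ j) * y $ j\<bar>
        \<le> A $ i $ j * e + \<bar>A $ i $ j - B $ i $ j\<bar>"
      by linarith
  qed
  also have "\<dots> = e + (\<Sum>j\<in>UNIV. \<bar>A $ i $ j - B $ i $ j\<bar>)"
    by (simp add: sum.distrib sum_distrib_right[symmetric] stochastic_matrixD(2)[OF A])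
  also have "(\<Sum>j\<in>UNIV. \<bar>A $ i $ j - B $ i $ j\<bar>)
      \<le> (\<Sum>i\<in>UNIV. \<Sum>j\<in>UNIV. \<bar>A $ i $ j - B $ i $ j\<bar>)"
    by (rule member_le_sum[of i UNIV "\<lambda>i. \<Sum>j\<in>UNIV. \<bar>A $ i $ j - B $ i $ j\<bar>"])
      (auto intro: sum_nonneg)
  finally show ?thesis by simp
qed

section \<open>Products of a chain and ergodicity of indices\<close>

primrec transition :: "(nat \<Rightarrow> real ^ 'n ^ 'n) \<Rightarrow> nat \<Rightarrow> nat \<Rightarrow> real ^ 'n ^ 'n" where
  "transition A s 0 = mat 1"
| "transition A s (Suc k) = A (s + k) ** transition A s k"

lemma transition_Suc_nth:
  "transition A s (Suc k) $ i $ j = (\<Sum>l\<in>UNIV. A (s + k) $ i $ l * transition A s k $ l $ j)"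
  by (simp add: matrix_matrix_mult_def)

lemma matrix_vector_mult_nth: "(T *v x) $ i = (\<Sum>l\<in>UNIV. T $ i $ l * x $ l)"
  by (simp add: matrix_vector_mult_def)

lemma stochastic_matrix_transition:
  assumes "\<And>k. stochastic_matrix (A k)"
  shows "stochastic_matrix (transition A s k)"
  by (induction k) (auto simp: stochastic_matrix_one stochastic_matrix_mult assms)

text \<open>The third argument of \<open>transition\<close> counts factors:
  \<open>transition A s k\<close> multiplies \<open>A (s + k - 1)\<close> down to
  \<open>A s\<close>, and each step of the dynamics adds one factor on the left.\<close>

lemma dynamics_transition:
  assumes "dynamics A s x"
  shows "x (s + k) = transition A s k *v x s"
  using assms by (induction k) (auto simp: dynamics_def matrix_vector_mul_assoc)

text \<open>Truncated subtraction makes this sequence equal to \<open>v\<close> at all times up to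
  \<open>s\<close>; as \<open>dynamics\<close> asks nothing before \<open>s\<close>, every start
  vector is realised.\<close>

lemma dynamics_of_transition: "dynamics A s (\<lambda>k. transition A s (k - s) *v v)"
  by (auto simp: dynamics_def Suc_diff_le matrix_vector_mul_assoc)

lemma mult_axis_nth: "((T :: real ^ 'n ^ 'n) *v axis j 1) $ i = T $ i $ j"
  by (simp add: matrix_vector_mult_basis column_def)


text \<open>By linearity it suffices to test basis vectors: started from \<open>axis j 1\<close> at
  time \<open>s\<close>, the trajectory is column \<open>j\<close> of the products. Only countably
  many conditions remain, which suits almost sure arguments.\<close>

lemma ergodic_index_iff_transition:
  "ergodic_index A i \<longleftrightarrow> (\<forall>s j. convergent (\<lambda>k. transition A s k $ i $ j))"
proof safe
  fix s j assume "ergodic_index A i"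
  then have "convergent (\<lambda>k. (transition A s (k - s) *v axis j 1) $ i)"
    unfolding ergodic_index_def using dynamics_of_transition by blast
  then have "convergent (\<lambda>k. transition A s (k - s) $ i $ j)"
    by (simp add: mult_axis_nth)
  then have "convergent (\<lambda>k. transition A s ((k + s) - s) $ i $ j)"
    by (subst convergent_ignore_initial_segment)
  then show "convergent (\<lambda>k. transition A s k $ i $ j)"
    by simp
next
  assume *: "\<forall>s j. convergent (\<lambda>k. transition A s k $ i $ j)"
  show "ergodic_index A i"
    unfolding ergodic_index_def
  proof safe
    fix s x assume x: "dynamics A s x"
    have shift: "x (k + s) = transition A s k *v x s" for k
      using dynamics_transition[OF x, of k] by (simp add: add.commute)
    have "convergent (\<lambda>k. \<Sum>l\<in>UNIV. transition A s k $ i $ l * x s $ l)"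
      using * by (intro convergent_sum convergent_mult convergent_const) auto
    then have "convergent (\<lambda>k. x (k + s) $ i)"
      by (simp add: shift matrix_vector_mult_nth)
    then show "convergent (\<lambda>k. x k $ i)"
      by (subst (asm) convergent_ignore_initial_segment)
  qed
qed

text \<open>Linearity again reduces all start vectors to the basis vectors.\<close>

lemma mutually_weakly_ergodic_iff_transition:
  "mutually_weakly_ergodic A i j \<longleftrightarrow>
     (\<forall>s l. (\<lambda>k. transition A s k $ i $ l - transition A s k $ j $ l) \<longlonglongrightarrow> 0)"
proof safe
  fix s l assume "mutually_weakly_ergodic A i j"
  then have "(\<lambda>k. (transition A s (k - s) *v axis l 1) $ i - (transition A s (k - s) *v axis l 1) $ j)
      \<longlonglongrightarrow> 0"
    unfolding mutually_weakly_ergodic_def using dynamics_of_transition by blast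
  then have "(\<lambda>k. transition A s (k - s) $ i $ l - transition A s (k - s) $ j $ l) \<longlonglongrightarrow> 0"
    by (simp add: mult_axis_nth)
  from LIMSEQ_ignore_initial_segment[OF this, of s]
  show "(\<lambda>k. transition A s k $ i $ l - transition A s k $ j $ l) \<longlonglongrightarrow> 0"
    by simp
next
  assume *: "\<forall>s l. (\<lambda>k. transition A s k $ i $ l - transition A s k $ j $ l) \<longlonglongrightarrow> 0"
  show "mutually_weakly_ergodic A i j"
    unfolding mutually_weakly_ergodic_def
  proof safe
    fix s x assume x: "dynamics A s x"
    have shift: "x (k + s) = transition A s k *v x s" for k
      using dynamics_transition[OF x, of k] by (simp add: add.commute)
    have "(\<lambda>k. \<Sum>l\<in>UNIV. (transition A s k $ i $ l - transition A s k $ j $ l) * x s $ l) \<longlonglongrightarrow> 0"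
      using * by (intro tendsto_null_sum tendsto_mult_left_zero) auto
    then have "(\<lambda>k. x (k + s) $ i - x (k + s) $ j) \<longlonglongrightarrow> 0"
      by (simp add: shift matrix_vector_mult_nth
          sum_subtractf left_diff_distrib)
    then show "(\<lambda>k. x k $ i - x k $ j) \<longlonglongrightarrow> 0"
      by (rule LIMSEQ_offset)
  qed
qed

lemma mutually_weakly_ergodic_trans:
  assumes "mutually_weakly_ergodic A i j" "mutually_weakly_ergodic A j l"
  shows "mutually_weakly_ergodic A i l"
  unfolding mutually_weakly_ergodic_def
proof safe
  fix s x assume x: "dynamics A s x"
  have "(\<lambda>k. (x k $ i - x k $ j) + (x k $ j - x k $ l)) \<longlonglongrightarrow> 0 + 0"
    using assms x unfolding mutually_weakly_ergodic_def by (intro tendsto_add) blast+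
  then show "(\<lambda>k. x k $ i - x k $ l) \<longlonglongrightarrow> 0"
    by simp
qed

text \<open>Follow \<open>B\<close> for \<open>n\<close> steps and then switch to \<open>A\<close>.
  Each later step adds at most the entrywise distance \<open>d\<close> of the two matrices to the
  error, since multiplication by a stochastic matrix does not enlarge it. A tail of the convergent
  series is below \<open>e\<close>, uniformly in \<open>k\<close>.\<close>

lemma transition_perturbation:
  fixes A B :: "nat \<Rightarrow> real ^ 'n ^ 'n"
  assumes A: "\<And>k. stochastic_matrix (A k)" and B: "\<And>k. stochastic_matrix (B k)"
    and AB: "\<And>i j. summable (\<lambda>k. \<bar>A k $ i $ j - B k $ i $ j\<bar>)" and "0 < e"
  shows "\<exists>n. \<forall>i k. \<bar>(transition A (s + n) k *v (transition B s n *v axis j 1)) $ i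
     - transition B s (n + k) $ i $ j\<bar> < e"
proof -
  define d where "d k = (\<Sum>i\<in>UNIV. \<Sum>j\<in>UNIV. \<bar>A k $ i $ j - B k $ i $ j\<bar>)" for k
  have d: "summable d"
    unfolding d_def by (intro summable_sum AB)
  have d0: "0 \<le> d k" for k
    unfolding d_def by (intro sum_nonneg) auto
  obtain N where N: "\<bar>\<Sum>k. d (k + n)\<bar> < e" if "n \<ge> N" for n
    using suminf_exist_split[OF \<open>0 < e\<close> d] by auto
  have "\<bar>(transition A (s + N) k *v (transition B s N *v axis j 1)) $ i
     - transition B s (N + k) $ i $ j\<bar> \<le> (\<Sum>r<k. d (s + N + r))" for i k
  proof (induction k arbitrary: i)
    case 0
    then show ?case by (simp add: mult_axis_nth)
  next
    case (Suc k)
    define x where "x = transition A (s + N) k *v (transition B s N *v axis j 1)"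
    define y where "y = transition B s (N + k) *v axis j 1"
    have "\<bar>y $ l\<bar> \<le> 1" for l
      using stochastic_matrixD(1,3)[OF stochastic_matrix_transition[of B s "N + k", OF B], of l j]
      by (simp add: y_def mult_axis_nth)
    moreover have "\<bar>x $ l - y $ l\<bar> \<le> (\<Sum>r<k. d (s + N + r))" for l
      using Suc[of l] by (simp add: x_def y_def mult_axis_nth)
    ultimately have "\<bar>(A (s + N + k) *v x) $ i - (B (s + N + k) *v y) $ i\<bar>
        \<le> (\<Sum>r<k. d (s + N + r)) + d (s + N + k)"
      unfolding d_def[of "s + N + k"] by (intro stochastic_matrix_diff_mult_vec_le A)
    moreover have "A (s + N + k) *v x = transition A (s + N) (Suc k) *v (transition B s N *v axis j 1)"
      by (simp add: x_def matrix_vector_mul_assoc matrix_mul_assoc)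
    moreover have "B (s + N + k) *v y = transition B s (N + Suc k) *v axis j 1"
      by (simp add: y_def matrix_vector_mul_assoc add.assoc)
    ultimately show ?case
      by (simp add: mult_axis_nth)
  qed
  moreover have "(\<Sum>r<k. d (s + N + r)) < e" for k
  proof -
    \<comment> \<open>The error accumulates only from time \<open>s + N\<close> on, which is at
      least \<open>N\<close>, so the same \<open>N\<close> serves every \<open>s\<close>.\<close>
    have "(\<Sum>r<k. d (r + (s + N))) \<le> (\<Sum>r. d (r + (s + N)))"
      using d d0 by (intro sum_le_suminf) (auto simp: summable_iff_shift)
    then show ?thesis
      using N[of "s + N"] by (simp add: add.commute)
  qed
  ultimately show ?thesis
    by (intro exI[of _ N]) (meson le_less_trans)
qed

text \<open>A trajectory of \<open>B\<close> stays within \<open>e / 3\<close> of a trajectory of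
  \<open>A\<close> started at time \<open>s + n\<close>, which is a Cauchy sequence; three such
  terms give the Cauchy criterion for \<open>B\<close>.\<close>

lemma stable_chain_perturbation:
  fixes A B :: "nat \<Rightarrow> real ^ 'n ^ 'n"
  assumes A: "\<And>k. stochastic_matrix (A k)" and B: "\<And>k. stochastic_matrix (B k)"
    and AB: "\<And>i j. summable (\<lambda>k. \<bar>A k $ i $ j - B k $ i $ j\<bar>)" and stable: "stable_chain A"
  shows "stable_chain B"
  unfolding stable_chain_def ergodic_index_iff_transition
proof (intro allI, rule Cauchy_convergent, rule metric_CauchyI)
  fix i j s and e :: real assume "0 < e"
  then have "0 < e / 3" by simp
  obtain n where n: "\<And>i k. \<bar>(transition A (s + n) k *v (transition B s n *v axis j 1)) $ i
     - transition B s (n + k) $ i $ j\<bar> < e / 3"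
    using transition_perturbation[OF A B AB \<open>0 < e / 3\<close>, of s j] by blast
  define z where "z k = (transition A (s + n) k *v (transition B s n *v axis j 1)) $ i" for k
  have "convergent (\<lambda>k. transition A (s + n) k $ i $ l)" for l
    using stable unfolding stable_chain_def ergodic_index_iff_transition by blast
  then have "convergent z"
    unfolding z_def matrix_vector_mult_nth by (intro convergent_sum convergent_mult convergent_const)
  then have "Cauchy z"
    by (rule convergent_Cauchy)
  then obtain K where K: "dist (z k) (z l) < e / 3" if "k \<ge> K" "l \<ge> K" for k l
    using metric_CauchyD[of z "e / 3"] \<open>0 < e / 3\<close> by blast
  show "\<exists>K. \<forall>k\<ge>K. \<forall>l\<ge>K. dist (transition B s k $ i $ j) (transition B s l $ i $ j) < e"
  proof (intro exI[of _ "n + K"] allI impI)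
    fix k l assume "n + K \<le> k" "n + K \<le> l"
    then obtain k' l' where "k = n + k'" "l = n + l'" "k' \<ge> K" "l' \<ge> K"
      by (metis add.assoc le_iff_add le_add1)
    then show "dist (transition B s k $ i $ j) (transition B s l $ i $ j) < e"
      using n[of k' i] n[of l' i] K[OF \<open>k' \<ge> K\<close> \<open>l' \<ge> K\<close>]
      unfolding z_def dist_real_def by (simp only:)
  qed
qed

text \<open>The trajectory of \<open>B\<close> is compared with one of \<open>A\<close>: the errors
  at \<open>i\<close> and at \<open>j\<close> and the vanishing difference under \<open>A\<close>
  contribute \<open>e / 3\<close> each.\<close>

lemma mutually_weakly_ergodic_perturbation:
  fixes A B :: "nat \<Rightarrow> real ^ 'n ^ 'n"
  assumes A: "\<And>k. stochastic_matrix (A k)" and B: "\<And>k. stochastic_matrix (B k)"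
    and AB: "\<And>i j. summable (\<lambda>k. \<bar>A k $ i $ j - B k $ i $ j\<bar>)"
    and erg: "mutually_weakly_ergodic A i j"
  shows "mutually_weakly_ergodic B i j"
  unfolding mutually_weakly_ergodic_iff_transition
proof (intro allI LIMSEQ_I)
  fix s l and e :: real assume "0 < e"
  then have "0 < e / 3" by simp
  obtain n where n: "\<And>i k. \<bar>(transition A (s + n) k *v (transition B s n *v axis l 1)) $ i
     - transition B s (n + k) $ i $ l\<bar> < e / 3"
    using transition_perturbation[OF A B AB \<open>0 < e / 3\<close>, of s l] by blast
  define z where "z k = transition A (s + n) k *v (transition B s n *v axis l 1)" for k
  have "(\<lambda>k. \<Sum>r\<in>UNIV. (transition A (s + n) k $ i $ r - transition A (s + n) k $ j $ r)
      * (transition B s n *v axis l 1) $ r) \<longlonglongrightarrow> 0"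
    using erg unfolding mutually_weakly_ergodic_iff_transition
    by (intro tendsto_null_sum tendsto_mult_left_zero) auto
  then have "(\<lambda>k. z k $ i - z k $ j) \<longlonglongrightarrow> 0"
    unfolding z_def matrix_vector_mult_nth[of _ "transition B s n *v axis l 1"]
    by (simp add: sum_subtractf left_diff_distrib)
  then obtain K where K: "\<bar>z k $ i - z k $ j\<bar> < e / 3" if "k \<ge> K" for k
    using LIMSEQ_D[of _ 0 "e / 3"] \<open>0 < e / 3\<close> by fastforce
  show "\<exists>K. \<forall>k\<ge>K. norm (transition B s k $ i $ l - transition B s k $ j $ l - 0) < e"
  proof (intro exI[of _ "n + K"] allI impI)
    fix k assume "n + K \<le> k"
    then obtain k' where "k = n + k'" "k' \<ge> K"
      by (metis add.assoc le_iff_add le_add1)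
    then show "norm (transition B s k $ i $ l - transition B s k $ j $ l - 0) < e"
      using n[of k' i] n[of k' j] K[OF \<open>k' \<ge> K\<close>]
      unfolding z_def real_norm_def by (simp only:)
  qed
qed

text \<open>Start the indicator vector of \<open>C\<close> so late that the remaining flow across
  the cut is below \<open>1 / 4\<close>. Values mix across the cut only in proportion to the flow,
  so those in \<open>C\<close> stay above \<open>3 / 4\<close> and the others below
  \<open>1 / 4\<close>.\<close>

lemma not_mutually_weakly_ergodic_of_summable_cut:
  fixes A :: "nat \<Rightarrow> real ^ 'n ^ 'n"
  assumes A: "\<And>k. stochastic_matrix (A k)"
    and cut: "\<And>u v. u \<in> C \<Longrightarrow> v \<notin> C \<Longrightarrow> summable (\<lambda>k. A k $ u $ v + A k $ v $ u)"
    and "i \<in> C" "j \<notin> C"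
  shows "\<not> mutually_weakly_ergodic A i j"
proof
  assume erg: "mutually_weakly_ergodic A i j"
  \<comment> \<open>Summing over all pairs and both directions gives one series that controls every
    row on either side of the cut.\<close>
  define f where "f k = (\<Sum>u\<in>C. \<Sum>v\<in>-C. A k $ u $ v + A k $ v $ u)" for k
  have A0: "0 \<le> A k $ u $ v" for k u v
    by (rule stochastic_matrixD(1)[OF A])
  have f: "summable f"
    unfolding f_def by (intro summable_sum cut) auto
  have f0: "0 \<le> f k" for k
    unfolding f_def by (intro sum_nonneg add_nonneg_nonneg A0)
  obtain s where s: "\<bar>\<Sum>k. f (k + s)\<bar> < 1 / 4"
    using suminf_exist_split[OF _ f, of "1 / 4"] by auto
  define v :: "real ^ 'n" where "v = (\<chi> l. if l \<in> C then 1 else 0)"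
  define x where "x k = transition A s k *v v" for k
  have x_Suc: "x (Suc k) $ l = (\<Sum>r\<in>UNIV. A (s + k) $ l $ r * x k $ r)" for k l
    by (simp add: x_def matrix_vector_mul_assoc[symmetric] matrix_vector_mult_nth)
  have out_flow: "(\<Sum>r\<in>-C. A k $ l $ r) \<le> f k" if "l \<in> C" for l k
  proof -
    have "(\<Sum>r\<in>-C. A k $ l $ r) \<le> (\<Sum>r\<in>-C. A k $ l $ r + A k $ r $ l)"
      by (intro sum_mono) (simp add: A0)
    also have "\<dots> \<le> f k"
      unfolding f_def using that
      by (intro member_le_sum[of l C "\<lambda>l. \<Sum>r\<in>-C. A k $ l $ r + A k $ r $ l"])
        (auto intro!: sum_nonneg add_nonneg_nonneg A0)
    finally show ?thesis .
  qed
  have in_flow: "(\<Sum>r\<in>C. A k $ l $ r) \<le> f k" if "l \<notin> C" for l k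
  proof -
    have "(\<Sum>r\<in>C. A k $ l $ r) \<le> (\<Sum>r\<in>C. A k $ r $ l + A k $ l $ r)"
      by (intro sum_mono) (simp add: A0)
    also have "\<dots> \<le> f k"
      unfolding f_def using that
      by (intro sum_mono member_le_sum[of l "-C" "\<lambda>l. A k $ _ $ l + A k $ l $ _"])
        (auto intro!: add_nonneg_nonneg A0)
    finally show ?thesis .
  qed
  \<comment> \<open>Values on \<open>C\<close> lose, and values outside gain, at most the flow
    accumulated so far. The bounds by \<open>0\<close> and \<open>1\<close> are carried along
    because they limit what a unit of flow can import from the other side.\<close>
  have bounds: "(\<forall>l. 0 \<le> x k $ l \<and> x k $ l \<le> 1) \<and> (\<forall>l\<in>C. 1 - (\<Sum>r<k. f (s + r)) \<le> x k $ l)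
      \<and> (\<forall>l\<in>-C. x k $ l \<le> (\<Sum>r<k. f (s + r)))" for k
  proof (induction k)
    case 0
    then show ?case by (simp add: x_def v_def)
  next
    case (Suc k)
    let ?S = "\<Sum>r<k. f (s + r)"
    have S0: "0 \<le> ?S"
      by (intro sum_nonneg f0)
    have x01: "0 \<le> x k $ l" "x k $ l \<le> 1" for l
      using Suc by auto
    have row: "(\<Sum>r\<in>UNIV. A (s + k) $ l $ r) = 1" for l
      by (rule stochastic_matrixD(2)[OF A])
    have le1: "x (Suc k) $ l \<le> 1" for l
    proof -
      have "x (Suc k) $ l \<le> (\<Sum>r\<in>UNIV. A (s + k) $ l $ r)"
        unfolding x_Suc by (intro sum_mono mult_left_le x01 A0)
      then show ?thesis by (simp add: row)
    qed
    have ge0: "0 \<le> x (Suc k) $ l" for l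
      unfolding x_Suc by (intro sum_nonneg mult_nonneg_nonneg x01 A0)
    have split: "(\<Sum>r\<in>UNIV. g r) = (\<Sum>r\<in>C. g r) + (\<Sum>r\<in>-C. g r)" for g :: "'n \<Rightarrow> real"
      using sum.union_disjoint[of C "-C" g] by (simp add: Compl_partition)
    have lower: "1 - (?S + f (s + k)) \<le> x (Suc k) $ l" if "l \<in> C" for l
    proof -
      \<comment> \<open>The deficit \<open>1 - x\<close> is itself averaged by the row: on
        \<open>C\<close> it is at most \<open>?S\<close> by induction, off \<open>C\<close> it is at
        most one and is weighted by the outflow.\<close>
      have "1 - x (Suc k) $ l = (\<Sum>r\<in>UNIV. A (s + k) $ l $ r * (1 - x k $ r))"
        unfolding x_Suc by (simp add: right_diff_distrib sum_subtractf row)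
      also have "\<dots> = (\<Sum>r\<in>C. A (s + k) $ l $ r * (1 - x k $ r))
          + (\<Sum>r\<in>-C. A (s + k) $ l $ r * (1 - x k $ r))"
        by (rule split)
      also have "\<dots> \<le> (\<Sum>r\<in>C. A (s + k) $ l $ r * ?S) + (\<Sum>r\<in>-C. A (s + k) $ l $ r)"
        using Suc x01 by (intro add_mono sum_mono mult_left_mono mult_left_le A0) fastforce+
      also have "(\<Sum>r\<in>C. A (s + k) $ l $ r * ?S) \<le> ?S"
      proof -
        have "(\<Sum>r\<in>C. A (s + k) $ l $ r) \<le> 1"
          unfolding row[of l, symmetric] by (intro sum_mono2) (auto simp: A0)
        then show ?thesis
          unfolding sum_distrib_right[symmetric] using S0 by (intro mult_left_le_one_le sum_nonneg A0 f0)
      qed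
      finally show ?thesis
        using out_flow[OF that, of "s + k"] by linarith
    qed
    have upper: "x (Suc k) $ l \<le> ?S + f (s + k)" if "l \<notin> C" for l
    proof -
      have "x (Suc k) $ l = (\<Sum>r\<in>C. A (s + k) $ l $ r * x k $ r) + (\<Sum>r\<in>-C. A (s + k) $ l $ r * x k $ r)"
        unfolding x_Suc by (rule split)
      also have "\<dots> \<le> (\<Sum>r\<in>C. A (s + k) $ l $ r) + (\<Sum>r\<in>-C. A (s + k) $ l $ r * ?S)"
        using Suc x01 by (intro add_mono sum_mono mult_left_mono mult_left_le A0) auto
      also have "(\<Sum>r\<in>-C. A (s + k) $ l $ r * ?S) \<le> ?S"
      proof -
        have "(\<Sum>r\<in>-C. A (s + k) $ l $ r) \<le> 1"
          unfolding row[of l, symmetric] by (intro sum_mono2) (auto simp: A0)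
        then show ?thesis
          unfolding sum_distrib_right[symmetric] using S0 by (intro mult_left_le_one_le sum_nonneg A0 f0)
      qed
      finally show ?thesis
        using in_flow[OF that, of "s + k"] by linarith
    qed
    show ?case
      using le1 ge0 lower upper by simp
  qed
  have small: "(\<Sum>r<k. f (s + r)) < 1 / 4" for k
  proof -
    have "(\<Sum>r<k. f (r + s)) \<le> (\<Sum>r. f (r + s))"
      using f f0 by (intro sum_le_suminf) (auto simp: summable_iff_shift)
    then show ?thesis
      using s by (simp add: add.commute)
  qed
  have gap: "1 / 2 \<le> x k $ i - x k $ j" for k
  proof -
    have "1 - (\<Sum>r<k. f (s + r)) \<le> x k $ i" "x k $ j \<le> (\<Sum>r<k. f (s + r))"
      using bounds[of k] \<open>i \<in> C\<close> \<open>j \<notin> C\<close> by blast+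
    then show ?thesis
      using small[of k] by linarith
  qed
  have "(\<lambda>k. x (k - s) $ i - x (k - s) $ j) \<longlonglongrightarrow> 0"
    using erg dynamics_of_transition[of A s v] unfolding mutually_weakly_ergodic_def x_def by blast
  then have "1 / 2 \<le> (0 :: real)"
    by (rule LIMSEQ_le_const) (use gap in auto)
  then show False by simp
qed

subsection \<open>Convergence of bounded sequences and supermartingales\<close>

text \<open>If the lower and upper limits differed, two rationals would lie strictly between them,
  against \<open>osc\<close>; boundedness makes the common value finite. Rational levels keep the
  conditions countable, so that they can hold almost surely together.\<close>

lemma convergent_if_no_oscillation:
  fixes u :: "nat \<Rightarrow> real"
  assumes "Bseq u"
    and osc: "\<And>a b :: rat. a < b \<Longrightarrow>
      (\<forall>\<^sub>F k in sequentially. real_of_rat a \<le> u k) \<or> (\<forall>\<^sub>F k in sequentially. u k \<le> real_of_rat b)"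
  shows "convergent u"
proof -
  let ?v = "\<lambda>k. ereal (u k)"
  have le: "liminf ?v \<le> limsup ?v"
    by (rule Liminf_le_Limsup) simp
  have "limsup ?v \<le> liminf ?v"
  proof (rule ccontr)
    assume "\<not> limsup ?v \<le> liminf ?v"
    then obtain a :: rat where a: "liminf ?v < real_of_rat a" "real_of_rat a < limsup ?v"
      using ereal_dense3 by (metis not_le)
    then obtain b :: rat where b: "ereal (real_of_rat a) < real_of_rat b" "real_of_rat b < limsup ?v"
      using ereal_dense3 by blast
    have "a < b"
      using b(1) by (simp add: of_rat_less)
    from osc[OF this] show False
    proof
      assume "\<forall>\<^sub>F k in sequentially. real_of_rat a \<le> u k"
      then have "real_of_rat a \<le> liminf ?v"
        by (intro Liminf_bounded) (auto elim: eventually_mono)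
      with a(1) show False by simp
    next
      assume "\<forall>\<^sub>F k in sequentially. u k \<le> real_of_rat b"
      then have "limsup ?v \<le> real_of_rat b"
        by (intro Limsup_bounded) (auto elim: eventually_mono)
      with b(2) show False by simp
    qed
  qed
  with le have eq: "liminf ?v = limsup ?v" by simp
  obtain K where K: "\<And>k. \<bar>u k\<bar> \<le> K"
    using \<open>Bseq u\<close> unfolding Bseq_def by auto
  have "limsup ?v \<le> ereal K" "ereal (-K) \<le> liminf ?v"
    using K by (auto intro!: Limsup_bounded Liminf_bounded always_eventually simp: abs_le_iff)
      (metis abs_le_D2 minus_le_iff)
  then obtain L where L: "limsup ?v = ereal L"
    using eq by (cases "limsup ?v") auto
  have "?v \<longlonglongrightarrow> ereal L"
    using eq L by (intro iffD2[OF tendsto_iff_Liminf_eq_Limsup]) auto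
  then show ?thesis
    by (auto simp: convergent_def)
qed

text \<open>Betting on the upcrossings of the interval from \<open>a\<close> to \<open>b\<close>: a unit is bought below \<open>a\<close> and
  held until the sequence exceeds \<open>b\<close>.\<close>

primrec holding :: "real \<Rightarrow> real \<Rightarrow> (nat \<Rightarrow> real) \<Rightarrow> nat \<Rightarrow> bool" where
  "holding a b u 0 \<longleftrightarrow> u 0 < a"
| "holding a b u (Suc k) \<longleftrightarrow> (if holding a b u k then u (Suc k) \<le> b else u (Suc k) < a)"

primrec upcrossings :: "real \<Rightarrow> real \<Rightarrow> (nat \<Rightarrow> real) \<Rightarrow> nat \<Rightarrow> nat" where
  "upcrossings a b u 0 = 0"
| "upcrossings a b u (Suc k) =
     upcrossings a b u k + (if holding a b u k \<and> b < u (Suc k) then 1 else 0)"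

text \<open>The right side is the gain of the betting strategy. A completed upcrossing earns at
  least \<open>b - a\<close>, and an open position was bought below \<open>a\<close>, so its gain so
  far is at least \<open>u n - a\<close>.\<close>

lemma upcrossings_gain:
  assumes "a \<le> b"
  shows "(b - a) * upcrossings a b u n + (if holding a b u n then u n - a else 0)
    \<le> (\<Sum>k<n. of_bool (holding a b u k) * (u (Suc k) - u k))"
proof (induction n)
  case 0
  then show ?case by simp
next
  case (Suc n)
  then show ?case
    using assms by (auto simp: algebra_simps split: if_splits)
qed

text \<open>A late value below \<open>a\<close> forces an open position and a later value above
  \<open>b\<close> forces a closed one, so a sale, which increases the counter, happens in
  between.\<close>

lemma upcrossings_unbounded:
  assumes "a < b" "\<exists>\<^sub>F k in sequentially. u k < a" "\<exists>\<^sub>F k in sequentially. b < u k"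
  shows "\<exists>n. m \<le> upcrossings a b u n"
proof (induction m)
  case 0
  then show ?case by simp
next
  case (Suc m)
  have mono: "upcrossings a b u k \<le> upcrossings a b u l" if "k \<le> l" for k l
    using that by (rule lift_Suc_mono_le[rotated]) simp
  from Suc obtain n where n: "m \<le> upcrossings a b u n" ..
  obtain k where k: "k \<ge> n" "u k < a"
    using assms(2) unfolding frequently_sequentially by blast
  have "holding a b u k"
    using k(2) \<open>a < b\<close> by (cases k) auto
  \<comment> \<open>Until the first sale after time \<open>k\<close> the position stays open; from
    then on the counter exceeds its value at \<open>k\<close>.\<close>
  have "holding a b u l \<or> upcrossings a b u k < upcrossings a b u l" if "k \<le> l" for l
    using that
  proof (induction rule: dec_induct)
    case base
    then show ?case using \<open>holding a b u k\<close> by simp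
  next
    case (step l)
    then show ?case using mono[of k l] by auto
  qed
  moreover obtain l where l: "l \<ge> k" "b < u l"
    using assms(3) unfolding frequently_sequentially by blast
  moreover have "\<not> holding a b u l"
    using l(2) \<open>a < b\<close> by (cases l) auto
  ultimately have "upcrossings a b u k < upcrossings a b u l"
    by blast
  then show ?case
    using n mono[OF k(1)] by (intro exI[of _ l]) simp
qed

text \<open>The assumption \<open>decreasing\<close> says that the conditional expectation of
  \<open>S (Suc k)\<close> given \<open>F k\<close> is at most \<open>S k\<close>. It is stated by
  integrals over events of \<open>F k\<close>, the form in which the betting strategy uses
  it.\<close>

locale bounded_supermartingale = prob_space M for M :: "'a measure" +
  fixes F :: "nat \<Rightarrow> 'a measure" and S :: "nat \<Rightarrow> 'a \<Rightarrow> real" and B :: real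
  assumes subalg: "\<And>k. subalgebra M (F k)"
    and filtration: "\<And>k. subalgebra (F (Suc k)) (F k)"
    and adapted: "\<And>k. S k \<in> borel_measurable (F k)"
    and bounds: "\<And>k \<omega>. \<omega> \<in> space M \<Longrightarrow> 0 \<le> S k \<omega>" "\<And>k \<omega>. \<omega> \<in> space M \<Longrightarrow> S k \<omega> \<le> B"
    and decreasing: "\<And>k A. A \<in> sets (F k) \<Longrightarrow>
      (\<integral>\<omega>. indicator A \<omega> * S (Suc k) \<omega> \<partial>M) \<le> (\<integral>\<omega>. indicator A \<omega> * S k \<omega> \<partial>M)"
begin

section \<open>Doob's upcrossing argument for bounded supermartingales\<close>

lemma space_F: "space (F k) = space M"
  using subalg[of k] unfolding subalgebra_def by simp

lemma S_measurable [measurable]: "S k \<in> borel_measurable M"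
  using measurable_from_subalg[OF subalg adapted] .

lemma integrable_mult_S:
  assumes "A \<in> sets M"
  shows "integrable M (\<lambda>\<omega>. indicator A \<omega> * S k \<omega>)"
proof (rule integrable_const_bound[of _ B])
  show "AE \<omega> in M. norm (indicator A \<omega> * S k \<omega>) \<le> B"
    using bounds order_trans[OF bounds] by (intro AE_I2) (auto simp: indicator_def)
qed (use assms in auto)

text \<open>Whether a unit is held at time \<open>k\<close> depends only on the values up to time
  \<open>k\<close>, so the bet on the next increment is an event to which \<open>decreasing\<close>
  applies.\<close>

lemma holding_sets: "{\<omega> \<in> space M. holding a b (\<lambda>k. S k \<omega>) k} \<in> sets (F k)"
proof (induction k)
  case 0
  have "{\<omega> \<in> space (F 0). S 0 \<omega> < a} \<in> sets (F 0)"
    using adapted[of 0] by measurable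
  then show ?case by (simp add: space_F)
next
  case (Suc k)
  let ?H = "{\<omega> \<in> space M. holding a b (\<lambda>k. S k \<omega>) k}"
  have "?H \<in> sets (F (Suc k))"
    using Suc filtration unfolding subalgebra_def by auto
  moreover have "{\<omega> \<in> space M. S (Suc k) \<omega> \<le> b} \<in> sets (F (Suc k))"
    "{\<omega> \<in> space M. S (Suc k) \<omega> < a} \<in> sets (F (Suc k))"
    using adapted[of "Suc k"] unfolding space_F[of "Suc k", symmetric] by measurable
  ultimately have "(?H \<inter> {\<omega> \<in> space M. S (Suc k) \<omega> \<le> b}) \<union>
      ({\<omega> \<in> space M. S (Suc k) \<omega> < a} - ?H) \<in> sets (F (Suc k))"
    by auto
  also have "(?H \<inter> {\<omega> \<in> space M. S (Suc k) \<omega> \<le> b}) \<union> ({\<omega> \<in> space M. S (Suc k) \<omega> < a} - ?H)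
      = {\<omega> \<in> space M. holding a b (\<lambda>k. S k \<omega>) (Suc k)}"
    by auto
  finally show ?case .
qed

lemma holding_measurable [measurable]: "Measurable.pred M (\<lambda>\<omega>. holding a b (\<lambda>k. S k \<omega>) k)"
  using holding_sets[of a b k] subalg[of k] unfolding subalgebra_def pred_def by blast

lemma upcrossings_measurable [measurable]:
  "(\<lambda>\<omega>. upcrossings a b (\<lambda>k. S k \<omega>) k) \<in> measurable M (count_space UNIV)"
  by (induction k) simp_all

text \<open>Betting on a supermartingale has nonpositive expected gain, and since \<open>S\<close>
  is nonnegative an open position costs at most \<open>\<bar>a\<bar>\<close>. The bound does not
  depend on \<open>n\<close>.\<close>

lemma expected_upcrossings_le:
  assumes "a < b"
  shows "(\<integral>\<^sup>+\<omega>. ennreal (upcrossings a b (\<lambda>k. S k \<omega>) n) \<partial>M) \<le> ennreal (\<bar>a\<bar> / (b - a))"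
proof -
  let ?U = "\<lambda>\<omega>. real (upcrossings a b (\<lambda>k. S k \<omega>) n)"
  let ?H = "\<lambda>k. {\<omega> \<in> space M. holding a b (\<lambda>k. S k \<omega>) k}"
  have H: "?H k \<in> sets M" for k
    using holding_measurable[of a b k] by (simp add: pred_def)
  define G where "G \<omega> = (\<Sum>k<n. indicator (?H k) \<omega> * S (Suc k) \<omega> - indicator (?H k) \<omega> * S k \<omega>)" for \<omega>
  have U_le: "upcrossings a b u k \<le> k" for u k
    by (induction k) auto
  have U_int: "integrable M ?U"
    using U_le by (intro integrable_const_bound[of _ n]) auto
  have G_int: "integrable M G"
    unfolding G_def by (intro Bochner_Integration.integrable_sum Bochner_Integration.integrable_diff integrable_mult_S H)
  have "integral\<^sup>L M G = (\<Sum>k<n. (\<integral>\<omega>. indicator (?H k) \<omega> * S (Suc k) \<omega> \<partial>M)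
      - (\<integral>\<omega>. indicator (?H k) \<omega> * S k \<omega> \<partial>M))"
    unfolding G_def by (simp add: integrable_mult_S H)
  also have "\<dots> \<le> 0"
    by (intro sum_nonpos) (simp add: decreasing holding_sets)
  finally have "integral\<^sup>L M G \<le> 0" .
  moreover have "(\<integral>\<omega>. (b - a) * ?U \<omega> \<partial>M) \<le> (\<integral>\<omega>. G \<omega> + \<bar>a\<bar> \<partial>M)"
  proof (rule integral_mono)
    fix \<omega> assume \<omega>: "\<omega> \<in> space M"
    have "G \<omega> = (\<Sum>k<n. of_bool (holding a b (\<lambda>k. S k \<omega>) k) * (S (Suc k) \<omega> - S k \<omega>))"
      unfolding G_def using \<omega> by (intro sum.cong) (auto simp: indicator_def)
    then show "(b - a) * ?U \<omega> \<le> G \<omega> + \<bar>a\<bar>"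
      using upcrossings_gain[of a b "\<lambda>k. S k \<omega>" n] bounds(1)[OF \<omega>, of n] \<open>a < b\<close>
      by (auto split: if_splits)
  qed (use U_int G_int in auto)
  ultimately have "(b - a) * integral\<^sup>L M ?U \<le> \<bar>a\<bar>"
    using G_int by (simp add: prob_space)
  then have "integral\<^sup>L M ?U \<le> \<bar>a\<bar> / (b - a)"
    using \<open>a < b\<close> by (simp add: field_simps)
  moreover have "(\<integral>\<^sup>+\<omega>. ennreal (?U \<omega>) \<partial>M) = ennreal (integral\<^sup>L M ?U)"
    using U_int by (intro nn_integral_eq_integral) auto
  ultimately show ?thesis
    by (simp add: ennreal_leI)
qed

text \<open>The expected upcrossing counts are bounded in \<open>n\<close>, so by monotone
  convergence their supremum is finite almost everywhere; oscillation across the interval would make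
  it infinite.\<close>

lemma AE_not_oscillating:
  assumes "a < b"
  shows "AE \<omega> in M. (\<forall>\<^sub>F k in sequentially. a \<le> S k \<omega>) \<or> (\<forall>\<^sub>F k in sequentially. S k \<omega> \<le> b)"
proof -
  let ?U = "\<lambda>n \<omega>. ennreal (upcrossings a b (\<lambda>k. S k \<omega>) n)"
  have "(\<integral>\<^sup>+\<omega>. (SUP n. ?U n \<omega>) \<partial>M) = (SUP n. (\<integral>\<^sup>+\<omega>. ?U n \<omega> \<partial>M))"
    by (intro nn_integral_monotone_convergence_SUP incseq_SucI) (auto simp: le_fun_def)
  also have "\<dots> \<le> ennreal (\<bar>a\<bar> / (b - a))"
    by (intro SUP_least expected_upcrossings_le assms)
  finally have "(\<integral>\<^sup>+\<omega>. (SUP n. ?U n \<omega>) \<partial>M) \<noteq> \<infinity>"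
    by (auto simp: top_unique)
  then have "AE \<omega> in M. (SUP n. ?U n \<omega>) \<noteq> \<infinity>"
    by (intro nn_integral_PInf_AE) auto
  then show ?thesis
  proof (rule AE_mp, intro AE_I2 impI)
    fix \<omega> assume fin: "(SUP n. ?U n \<omega>) \<noteq> \<infinity>"
    show "(\<forall>\<^sub>F k in sequentially. a \<le> S k \<omega>) \<or> (\<forall>\<^sub>F k in sequentially. S k \<omega> \<le> b)"
    proof (rule ccontr)
      assume "\<not> ?thesis"
      then have "\<exists>n. m \<le> upcrossings a b (\<lambda>k. S k \<omega>) n" for m
        by (intro upcrossings_unbounded assms) (auto simp: frequently_def not_less)
      then have "of_nat m \<le> (SUP n. ?U n \<omega>)" for m
        by (metis SUP_upper2 UNIV_I ennreal_of_nat_eq_real_of_nat of_nat_mono)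
      then have "(SUP n. ?U n \<omega>) = \<infinity>"
        using ennreal_SUP_of_nat_eq_top by (metis SUP_least infinity_ennreal_def top_unique)
      with fin show False by contradiction
    qed
  qed
qed

text \<open>There are countably many pairs of rationals, so one null set excludes oscillation across
  all of them.\<close>

lemma AE_convergent: "AE \<omega> in M. convergent (\<lambda>k. S k \<omega>)"
proof -
  have "AE \<omega> in M. \<forall>a b :: rat. a < b \<longrightarrow>
    (\<forall>\<^sub>F k in sequentially. real_of_rat a \<le> S k \<omega>) \<or> (\<forall>\<^sub>F k in sequentially. S k \<omega> \<le> real_of_rat b)"
    by (simp add: AE_all_countable AE_not_oscillating of_rat_less)
  with AE_space show ?thesis
  proof eventually_elim
    case (elim \<omega>)
    have "Bseq (\<lambda>k. S k \<omega>)"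
      using bounds[OF elim(1)] by (intro BseqI'[of _ B]) auto
    then show ?case
      using elim(2) by (intro convergent_if_no_oscillation) auto
  qed
qed

end

subsection \<open>Sequences with vanishing increments\<close>

text \<open>An oscillating sequence passes some level \<open>c\<close> that is not a zero of
  \<open>g\<close>, and crosses it upwards infinitely often. As the increments vanish, the values at
  the crossings tend to \<open>c\<close>, which forces \<open>g c = 0\<close> by continuity.\<close>

lemma convergent_if_increments_vanish:
  fixes u :: "nat \<Rightarrow> real" and g :: "real \<Rightarrow> real"
  assumes "Bseq u" and inc: "(\<lambda>k. u (Suc k) - u k) \<longlonglongrightarrow> 0"
    and gu: "(\<lambda>k. g (u k)) \<longlonglongrightarrow> 0" and g: "continuous_on UNIV g" and fin: "finite {t. g t = 0}"
  shows "convergent u"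
proof (rule convergent_if_no_oscillation[OF \<open>Bseq u\<close>])
  fix a b :: rat assume "a < b"
  then have "infinite ({real_of_rat a<..<real_of_rat b} - {t. g t = 0})"
    using fin by (simp add: of_rat_less)
  then have "{real_of_rat a<..<real_of_rat b} - {t. g t = 0} \<noteq> {}"
    by (rule infinite_imp_nonempty)
  then obtain c where "c \<in> {real_of_rat a<..<real_of_rat b} - {t. g t = 0}"
    by blast
  then have c: "real_of_rat a < c" "c < real_of_rat b" "g c \<noteq> 0"
    by auto
  have "(\<forall>\<^sub>F k in sequentially. c \<le> u k) \<or> (\<forall>\<^sub>F k in sequentially. u k \<le> c)"
  proof (rule ccontr)
    assume "\<not> ?thesis"
    then have below: "\<exists>k\<ge>n. u k < c" and above: "\<exists>k\<ge>n. c < u k" for n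
      by (auto simp: eventually_sequentially not_le)
    have cross: "\<exists>k\<ge>n. u k < c \<and> c \<le> u (Suc k)" for n
    proof -
      obtain k where k: "k \<ge> n" "u k < c"
        using below by blast
      obtain l where l: "l \<ge> k" "c < u l"
        using above by blast
      show ?thesis
      proof (rule ccontr)
        assume *: "\<not> ?thesis"
        have "u l < c"
          using \<open>l \<ge> k\<close>
        proof (induction rule: dec_induct)
          case (step r)
          then show ?case using * k(1) by (meson le_trans not_le)
        qed (use k in simp)
        with l show False by simp
      qed
    qed
    then obtain r where r: "r n \<ge> n" "u (r n) < c" "c \<le> u (Suc (r n))" for n
      by metis
    have r_top: "filterlim r at_top sequentially"
      by (rule filterlim_at_top_mono[OF filterlim_ident]) (simp add: r(1))
    \<comment> \<open>At a crossing \<open>c\<close> lies between \<open>u (r n)\<close> and its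
      successor, so the distance to \<open>c\<close> is at most the increment.\<close>
    have "(\<lambda>n. u (r n) - c) \<longlonglongrightarrow> 0"
    proof (rule Lim_null_comparison)
      show "(\<lambda>n. u (Suc (r n)) - u (r n)) \<longlonglongrightarrow> 0"
        by (rule filterlim_compose[OF inc r_top])
      show "\<forall>\<^sub>F n in sequentially. norm (u (r n) - c) \<le> u (Suc (r n)) - u (r n)"
        using r(2,3) by (intro always_eventually allI) (auto simp: abs_if intro: less_imp_le)
    qed
    then have "(\<lambda>n. u (r n)) \<longlonglongrightarrow> c"
      by (simp add: LIM_zero_iff)
    then have "(\<lambda>n. g (u (r n))) \<longlonglongrightarrow> g c"
      using g by (intro isCont_tendsto_compose[of c g]) (auto simp: continuous_on_eq_continuous_at)
    moreover have "(\<lambda>n. g (u (r n))) \<longlonglongrightarrow> 0"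
      by (rule filterlim_compose[OF gu r_top])
    ultimately show False
      using c(3) LIMSEQ_unique by blast
  qed
  then show "(\<forall>\<^sub>F k in sequentially. real_of_rat a \<le> u k) \<or> (\<forall>\<^sub>F k in sequentially. u k \<le> real_of_rat b)"
  proof (rule disj_forward)
    assume "\<forall>\<^sub>F k in sequentially. c \<le> u k"
    then show "\<forall>\<^sub>F k in sequentially. real_of_rat a \<le> u k"
      by (rule eventually_mono) (use c(1) in auto)
  next
    assume "\<forall>\<^sub>F k in sequentially. u k \<le> c"
    then show "\<forall>\<^sub>F k in sequentially. u k \<le> real_of_rat b"
      by (rule eventually_mono) (use c(2) in auto)
  qed
qed

text \<open>The power sums determine the limiting distribution of the values \<open>x k $ i\<close>, hence confine
  them to a finite set; small increments then prevent jumps between its points.\<close>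

lemma convergent_if_power_sums_converge:
  fixes x :: "nat \<Rightarrow> real ^ 'n" and w :: "real ^ 'n"
  assumes w: "\<And>i. 0 < w $ i" and x: "\<And>k i. \<bar>x k $ i\<bar> \<le> 1"
    and powers: "\<And>p. convergent (\<lambda>k. \<Sum>i\<in>UNIV. w $ i * x k $ i ^ p)"
    and inc: "\<And>i. (\<lambda>k. x (Suc k) $ i - x k $ i) \<longlonglongrightarrow> 0"
  shows "convergent (\<lambda>k. x k $ i)"
proof -
  have polys: "convergent (\<lambda>k. \<Sum>i\<in>UNIV. w $ i * poly q (x k $ i))" for q
  proof -
    have "convergent (\<lambda>k. \<Sum>p\<le>degree q. coeff q p * (\<Sum>i\<in>UNIV. w $ i * x k $ i ^ p))"
      by (intro convergent_sum convergent_mult convergent_const powers)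
    moreover have "(\<Sum>p\<le>degree q. coeff q p * (\<Sum>i\<in>UNIV. w $ i * x k $ i ^ p))
        = (\<Sum>i\<in>UNIV. w $ i * poly q (x k $ i))" for k
      unfolding poly_altdef sum_distrib_left by (subst sum.swap) (simp add: mult_ac)
    ultimately show ?thesis by simp
  qed
  have "bounded (range x)"
    unfolding bounded_iff
  proof (intro exI ballI)
    fix v assume "v \<in> range x"
    then have "(\<Sum>i\<in>UNIV. \<bar>v $ i\<bar>) \<le> (\<Sum>i\<in>(UNIV::'n set). 1)"
      using x by (intro sum_mono) auto
    then show "norm v \<le> CARD('n)"
      using norm_le_l1_cart[of v] by simp
  qed
  \<comment> \<open>A limit point \<open>y\<close> exists by compactness; its coordinates supply the
    finite set to which all coordinates will be confined.\<close>
  then obtain y r where r: "strict_mono r" "(x \<circ> r) \<longlonglongrightarrow> y"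
    using bounded_imp_convergent_subsequence by blast
  \<comment> \<open>\<open>q\<close> vanishes exactly at the coordinates of \<open>y\<close>. The
    squares make it nonnegative, so that a small weighted sum forces every term to be small.\<close>
  define q where "q = (\<Prod>j\<in>UNIV. [:- (y $ j), 1:]\<^sup>2)"
  have q: "poly q t = (\<Prod>j\<in>UNIV. (t - y $ j)\<^sup>2)" for t
    unfolding q_def by (simp add: poly_prod)
  obtain L where L: "(\<lambda>k. \<Sum>i\<in>UNIV. w $ i * poly q (x k $ i)) \<longlonglongrightarrow> L"
    using polys[of q] unfolding convergent_def by blast
  have "(\<lambda>k. \<Sum>i\<in>UNIV. w $ i * poly q (x (r k) $ i)) \<longlonglongrightarrow> (\<Sum>i\<in>UNIV. w $ i * poly q (y $ i))"
    using r(2) by (intro tendsto_intros tendsto_poly tendsto_vec_nth) (simp add: comp_def)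
  also have "(\<Sum>i\<in>UNIV. w $ i * poly q (y $ i)) = 0"
    by (intro sum.neutral ballI) (auto simp: q)
  \<comment> \<open>The weighted sum of \<open>q\<close> converges along the whole sequence, so its
    limit is the one found along the subsequence.\<close>
  finally have "L = 0"
    using LIMSEQ_subseq_LIMSEQ[OF L r(1)] by (simp add: comp_def LIMSEQ_unique)
  have "(\<lambda>k. poly q (x k $ i)) \<longlonglongrightarrow> 0"
  proof (rule Lim_null_comparison)
    have q0: "0 \<le> poly q t" for t
      unfolding q by (intro prod_nonneg) auto
    have "w $ i * poly q (x k $ i) \<le> (\<Sum>i\<in>UNIV. w $ i * poly q (x k $ i))" for k
      using w q0 by (intro member_le_sum[of i UNIV "\<lambda>i. w $ i * poly q (x k $ i)"])
        (auto simp: mult_nonneg_nonneg[OF less_imp_le[OF w] q0])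
    then show "\<forall>\<^sub>F k in sequentially. norm (poly q (x k $ i))
        \<le> (\<Sum>i\<in>UNIV. w $ i * poly q (x k $ i)) / w $ i"
      using w[of i] q0 by (intro always_eventually allI) (simp add: field_simps)
    show "(\<lambda>k. (\<Sum>i\<in>UNIV. w $ i * poly q (x k $ i)) / w $ i) \<longlonglongrightarrow> 0"
      using L \<open>L = 0\<close> w[of i] by (auto intro!: tendsto_eq_intros)
  qed
  moreover have "finite {t. poly q t = 0}"
    unfolding q by (simp add: full_SetCompr_eq)
  moreover have "Bseq (\<lambda>k. x k $ i)"
    using x by (intro BseqI'[of _ 1]) auto
  ultimately show ?thesis
    using inc[of i] by (intro convergent_if_increments_vanish[of _ "poly q"])
      (auto intro: continuous_intros)
qed

subsection \<open>Series of random variables\<close>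

lemma suminf_ennreal_eq_infinity_iff:
  fixes f :: "nat \<Rightarrow> real"
  assumes "\<And>k. 0 \<le> f k"
  shows "(\<Sum>k. ennreal (f k)) = \<infinity> \<longleftrightarrow> \<not> summable f"
  using summable_suminf_not_top[of f, OF assms] ennreal_suminf_neq_top[of f, OF _ assms]
  by (metis infinity_ennreal_def)

text \<open>The expectation of the whole series is the sum of the expectations, hence finite, and a
  nonnegative variable with finite expectation is finite almost everywhere.\<close>

lemma AE_summable_if_summable_integral:
  fixes f :: "nat \<Rightarrow> 'a \<Rightarrow> real"
  assumes int: "\<And>k. integrable M (f k)" and nonneg: "\<And>k \<omega>. \<omega> \<in> space M \<Longrightarrow> 0 \<le> f k \<omega>"
    and summable: "summable (\<lambda>k. integral\<^sup>L M (f k))"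
  shows "AE \<omega> in M. summable (\<lambda>k. f k \<omega>)"
proof -
  have [measurable]: "f k \<in> borel_measurable M" for k
    using int by auto
  have "(\<integral>\<^sup>+\<omega>. (\<Sum>k. ennreal (f k \<omega>)) \<partial>M) = (\<Sum>k. \<integral>\<^sup>+\<omega>. ennreal (f k \<omega>) \<partial>M)"
    by (rule nn_integral_suminf) measurable
  also have "\<dots> = (\<Sum>k. ennreal (integral\<^sup>L M (f k)))"
    using int nonneg by (intro suminf_cong nn_integral_eq_integral) auto
  also have "\<dots> \<noteq> \<infinity>"
  proof -
    have "0 \<le> integral\<^sup>L M (f k)" for k
      using nonneg by (intro integral_nonneg_AE) auto
    with summable show ?thesis
      by (simp add: ennreal_suminf_neq_top)
  qed
  finally have "AE \<omega> in M. (\<Sum>k. ennreal (f k \<omega>)) \<noteq> \<infinity>"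
    by (intro nn_integral_PInf_AE) auto
  with AE_space show ?thesis
  proof eventually_elim
    case (elim \<omega>)
    then show ?case
      using nonneg suminf_ennreal_eq_infinity_iff[of "\<lambda>k. f k \<omega>"] by blast
  qed
qed

text \<open>As \<open>1 + x \<le> exp x\<close>, it suffices that
  \<open>(1 + x) * (1 - x / 3)\<close> is at least one, and it exceeds one by
  \<open>x * (2 - x) / 3\<close>. The range up to \<open>2\<close> is that of the flow between two
  indices, a sum of two entries.\<close>

lemma exp_minus_le:
  fixes x :: real
  assumes "0 \<le> x" "x \<le> 2"
  shows "exp (- x) \<le> 1 - x / 3"
proof -
  have "1 \<le> (1 + x) * (1 - x / 3)"
    using mult_nonneg_nonneg[of x "2 - x"] assms by (simp add: algebra_simps)
  also have "\<dots> \<le> exp x * (1 - x / 3)"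
    using assms by (intro mult_right_mono exp_ge_add_one_self) auto
  finally show ?thesis
    by (simp add: exp_minus field_simps)
qed

text \<open>The expectation of \<open>exp (- (\<Sum>k<n. X k))\<close> factorizes and tends to zero.\<close>

lemma (in prob_space) AE_not_summable_if_indep:
  fixes X :: "nat \<Rightarrow> 'a \<Rightarrow> real"
  assumes indep: "indep_vars (\<lambda>_. borel) X UNIV"
    and X: "\<And>k \<omega>. \<omega> \<in> space M \<Longrightarrow> 0 \<le> X k \<omega>" "\<And>k \<omega>. \<omega> \<in> space M \<Longrightarrow> X k \<omega> \<le> 2"
    and div: "\<not> summable (\<lambda>k. expectation (X k))"
  shows "AE \<omega> in M. \<not> summable (\<lambda>k. X k \<omega>)"
proof -
  have [measurable]: "X k \<in> borel_measurable M" for k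
    using indep unfolding indep_vars_def by auto
  have X_int: "integrable M (X k)" for k
    using X by (intro integrable_const_bound[of _ 2]) auto
  have E0: "0 \<le> expectation (X k)" for k
    using X(1) by (intro integral_nonneg_AE) auto
  have exp_int: "integrable M (\<lambda>\<omega>. exp (- X k \<omega>))" for k
    using X(1) by (intro integrable_const_bound[of _ 1]) auto
  \<comment> \<open>On the range of \<open>X k\<close> a linear bound for the exponential brings the
    expectation inside; returning to an exponential turns the later product into a sum.\<close>
  have exp_le: "expectation (\<lambda>\<omega>. exp (- X k \<omega>)) \<le> exp (- (expectation (X k) / 3))" for k
  proof -
    have "expectation (\<lambda>\<omega>. exp (- X k \<omega>)) \<le> expectation (\<lambda>\<omega>. 1 - X k \<omega> / 3)"
      using X X_int exp_int by (intro integral_mono exp_minus_le) auto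
    also have "\<dots> = 1 - expectation (X k) / 3"
      using X_int by (simp add: prob_space)
    also have "\<dots> \<le> exp (- (expectation (X k) / 3))"
      using exp_ge_add_one_self[of "- (expectation (X k) / 3)"] by simp
    finally show ?thesis .
  qed
  define S where "S n \<omega> = (\<Sum>k<n. X k \<omega>)" for n \<omega>
  have [measurable]: "S n \<in> borel_measurable M" for n
    unfolding S_def by measurable
  have S0: "0 \<le> S n \<omega>" if "\<omega> \<in> space M" for n \<omega>
    unfolding S_def using X(1)[OF that] by (intro sum_nonneg)
  have exp_S_int: "integrable M (\<lambda>\<omega>. exp (- S n \<omega>))" for n
    using S0 by (intro integrable_const_bound[of _ 1]) auto
  have exp_S: "expectation (\<lambda>\<omega>. exp (- S n \<omega>)) \<le> exp (- (\<Sum>k<n. expectation (X k)) / 3)" for n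
  proof -
    have "indep_vars (\<lambda>_. borel) (\<lambda>k \<omega>. exp (- X k \<omega>)) {..<n}"
      by (rule indep_vars_compose2[where Y = "\<lambda>_ x. exp (- x)"])
        (auto intro: indep_vars_subset[OF indep])
    then have "expectation (\<lambda>\<omega>. \<Prod>k<n. exp (- X k \<omega>)) = (\<Prod>k<n. expectation (\<lambda>\<omega>. exp (- X k \<omega>)))"
      using exp_int by (intro indep_vars_lebesgue_integral) auto
    also have "\<dots> \<le> (\<Prod>k<n. exp (- (expectation (X k) / 3)))"
      by (intro prod_mono conjI exp_le integral_nonneg_AE) auto
    also have "\<dots> = exp (- (\<Sum>k<n. expectation (X k)) / 3)"
      unfolding exp_sum[OF finite_lessThan, symmetric] by (simp add: sum_negf sum_divide_distrib)
    finally show ?thesis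
      unfolding exp_sum[OF finite_lessThan, symmetric] S_def by (simp add: sum_negf)
  qed
  have "(\<integral>\<^sup>+\<omega>. (INF n. ennreal (exp (- S n \<omega>))) \<partial>M) \<le> ennreal e" if "0 < e" for e
  proof -
    \<comment> \<open>The threshold solves \<open>exp (- t / 3) = e\<close> for \<open>t\<close>. It
      is reached because bounded partial sums of nonnegative terms would be summable.\<close>
    obtain n where n: "- 3 * ln e \<le> (\<Sum>k<n. expectation (X k))"
    proof (rule ccontr)
      assume "\<not> thesis"
      then have "(\<Sum>k<n. expectation (X k)) \<le> - 3 * ln e" for n
        using that by (meson linear)
      then have "summable (\<lambda>k. expectation (X k))"
        using E0 by (intro summableI_nonneg_bounded)
      with div show False by contradiction
    qed
    have "(\<integral>\<^sup>+\<omega>. (INF n. ennreal (exp (- S n \<omega>))) \<partial>M) \<le> (\<integral>\<^sup>+\<omega>. ennreal (exp (- S n \<omega>)) \<partial>M)"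
      by (intro nn_integral_mono INF_lower) simp
    also have "\<dots> = ennreal (expectation (\<lambda>\<omega>. exp (- S n \<omega>)))"
      by (intro nn_integral_eq_integral exp_S_int) simp
    also have "\<dots> \<le> ennreal e"
    proof (rule ennreal_leI)
      have "exp (- (\<Sum>k<n. expectation (X k)) / 3) \<le> exp (ln e)"
        using n by simp
      then show "expectation (\<lambda>\<omega>. exp (- S n \<omega>)) \<le> e"
        using exp_S[of n] that by simp
    qed
    finally show ?thesis .
  qed
  then have "(\<integral>\<^sup>+\<omega>. (INF n. ennreal (exp (- S n \<omega>))) \<partial>M) \<le> 0"
    by (intro ennreal_le_epsilon[of 0]) simp
  then have "(\<integral>\<^sup>+\<omega>. (INF n. ennreal (exp (- S n \<omega>))) \<partial>M) = 0"
    by simp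
  then have "AE \<omega> in M. (INF n. ennreal (exp (- S n \<omega>))) = 0"
    by (subst (asm) nn_integral_0_iff_AE) auto
  with AE_space show ?thesis
  proof eventually_elim
    case (elim \<omega>)
    show ?case
    proof
      assume "summable (\<lambda>k. X k \<omega>)"
      then have "S n \<omega> \<le> (\<Sum>k. X k \<omega>)" for n
        unfolding S_def using X(1)[OF elim(1)] by (intro sum_le_suminf) auto
      \<comment> \<open>A convergent series would keep all the exponentials above a positive
        constant, so their infimum could not be zero.\<close>
      then have "ennreal (exp (- (\<Sum>k. X k \<omega>))) \<le> (INF n. ennreal (exp (- S n \<omega>)))"
        by (intro INF_greatest ennreal_leI) simp
      with elim(2) show False
        by (simp add: ennreal_eq_0_iff)
    qed
  qed
qed

subsection \<open>Independent chains\<close>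

locale independent_chain = prob_space M for M :: "'a measure" +
  fixes V :: "nat \<Rightarrow> 'a \<Rightarrow> real ^ 'n ^ 'n"
  assumes stochastic: "\<And>k \<omega>. \<omega> \<in> space M \<Longrightarrow> stochastic_matrix (V k \<omega>)"
    and indep: "indep_vars (\<lambda>_. borel) V UNIV"
begin

section \<open>Entries of the random matrices and their expectations\<close>

lemma V_measurable [measurable]: "V k \<in> borel_measurable M"
  using indep unfolding indep_vars_def by auto

lemma entry_measurable_borel [measurable]:
  "(\<lambda>A :: real ^ 'n ^ 'n. A $ i $ j) \<in> borel_measurable borel"
  by (intro borel_measurable_continuous_onI continuous_intros)

lemma entry_measurable: "(\<lambda>\<omega>. V k \<omega> $ i $ j) \<in> borel_measurable M"
  by (rule measurable_compose[OF V_measurable entry_measurable_borel])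

lemma entry_bounds:
  assumes "\<omega> \<in> space M"
  shows "0 \<le> V k \<omega> $ i $ j" "V k \<omega> $ i $ j \<le> 1" "(\<Sum>j\<in>UNIV. V k \<omega> $ i $ j) = 1"
  using stochastic_matrixD[OF stochastic[OF assms]] by auto

lemma integrable_entry: "integrable M (\<lambda>\<omega>. V k \<omega> $ i $ j)"
proof (rule integrable_const_bound[of _ 1])
  show "AE \<omega> in M. norm (V k \<omega> $ i $ j) \<le> 1"
    using entry_bounds by (intro AE_I2) auto
qed (rule entry_measurable)

text \<open>Evaluating an entry is a bounded linear map, and the matrices are integrable because
  their entries are bounded, so evaluation commutes with the integral.\<close>

lemma expected_chain_nth: "expected_chain M V k $ i $ j = expectation (\<lambda>\<omega>. V k \<omega> $ i $ j)"
proof -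
  have "integrable M (V k)"
  proof (rule integrable_const_bound)
    show "AE \<omega> in M. norm (V k \<omega>) \<le> CARD('n) * CARD('n)"
    proof (rule AE_I2)
      fix \<omega> assume \<omega>: "\<omega> \<in> space M"
      have "norm (V k \<omega>) \<le> (\<Sum>i\<in>UNIV. norm (V k \<omega> $ i))"
        by (simp add: norm_vec_def L2_set_le_sum)
      also have "\<dots> \<le> (\<Sum>i\<in>(UNIV :: 'n set). real CARD('n))"
      proof (rule sum_mono)
        fix i
        have "norm (V k \<omega> $ i) \<le> (\<Sum>j\<in>UNIV. norm (V k \<omega> $ i $ j))"
          by (simp add: norm_vec_def L2_set_le_sum)
        also have "\<dots> \<le> (\<Sum>j\<in>(UNIV :: 'n set). 1)"
          using entry_bounds[OF \<omega>] by (intro sum_mono) auto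
        finally show "norm (V k \<omega> $ i) \<le> CARD('n)" by simp
      qed
      finally show "norm (V k \<omega>) \<le> CARD('n) * CARD('n)" by simp
    qed
  qed (rule V_measurable)
  moreover have "bounded_linear (\<lambda>A :: real ^ 'n ^ 'n. A $ i $ j)"
    by (intro bounded_linear_compose[OF bounded_linear_vec_nth] bounded_linear_vec_nth)
  ultimately show ?thesis
    unfolding expected_chain_def by (intro integral_bounded_linear[symmetric])
qed

lemma stochastic_expected_chain: "stochastic_matrix (expected_chain M V k)"
proof -
  have "(\<Sum>j\<in>UNIV. expectation (\<lambda>\<omega>. V k \<omega> $ i $ j)) = 1" for i
  proof -
    have "(\<Sum>j\<in>UNIV. expectation (\<lambda>\<omega>. V k \<omega> $ i $ j)) = expectation (\<lambda>\<omega>. \<Sum>j\<in>UNIV. V k \<omega> $ i $ j)"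
      by (simp add: integrable_entry)
    also have "\<dots> = expectation (\<lambda>_. 1)"
      by (intro Bochner_Integration.integral_cong) (auto simp: entry_bounds)
    finally show ?thesis by (simp add: prob_space)
  qed
  then show ?thesis
    unfolding stochastic_matrix_def expected_chain_nth
    by (auto intro!: integral_nonneg_AE simp: entry_bounds)
qed

text \<open>The natural filtration, generated by the matrices at times before \<open>k\<close>, with
  time \<open>k\<close> itself excluded. Generating it by a single map into a product space makes
  each of its sets a preimage, ready for the independence of blocks of variables.\<close>

definition history :: "nat \<Rightarrow> 'a measure" where
  "history k = vimage_algebra (space M) (\<lambda>\<omega>. \<lambda>i\<in>{..<k}. V i \<omega>) (Pi\<^sub>M {..<k} (\<lambda>_. borel))"

lemma space_history: "space (history k) = space M"
  unfolding history_def by simp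

lemma past_measurable: "(\<lambda>\<omega>. \<lambda>i\<in>{..<k}. V i \<omega>) \<in> measurable (history k) (Pi\<^sub>M {..<k} (\<lambda>_. borel))"
  unfolding history_def by (rule measurable_vimage_algebra1) (auto simp: space_PiM)

lemma V_history:
  assumes "i < k"
  shows "V i \<in> borel_measurable (history k)"
proof -
  have "(\<lambda>\<omega>. (\<lambda>i\<in>{..<k}. V i \<omega>) i) \<in> borel_measurable (history k)"
    using assms by (intro measurable_compose[OF past_measurable measurable_component_singleton]) auto
  with assms show ?thesis by simp
qed

lemma subalgebra_history:
  assumes "space N = space M" and "\<And>i. i < k \<Longrightarrow> V i \<in> borel_measurable N"
  shows "subalgebra N (history k)"
proof -
  have "(\<lambda>\<omega>. \<lambda>i\<in>{..<k}. V i \<omega>) \<in> measurable N (Pi\<^sub>M {..<k} (\<lambda>_. borel))"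
    using assms(2) by (intro measurable_restrict) auto
  then have "sets (history k) \<subseteq> sets N"
    unfolding history_def using assms(1) by (intro sets_image_in_sets) auto
  then show ?thesis
    unfolding subalgebra_def space_history using assms(1) by simp
qed

lemma subalgebra_M_history: "subalgebra M (history k)"
  by (rule subalgebra_history) simp_all

lemma subalgebra_history_Suc: "subalgebra (history (Suc k)) (history k)"
  by (rule subalgebra_history) (simp_all add: space_history V_history)

lemma measurable_history: "Y \<in> borel_measurable (history k) \<Longrightarrow> Y \<in> borel_measurable M"
  by (rule measurable_from_subalg[OF subalgebra_M_history])

text \<open>The index blocks \<open>{k}\<close> and \<open>{..<k}\<close> are disjoint and hence
  independent; functions of the blocks generate smaller sigma algebras, to which independence
  passes.\<close>

lemma indep_history:
  fixes Y :: "'a \<Rightarrow> real"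
  assumes Y: "Y \<in> borel_measurable (history k)" and g: "g \<in> borel_measurable borel"
  shows "indep_var borel (\<lambda>\<omega>. g (V k \<omega>) :: real) borel Y"
proof -
  let ?past = "\<lambda>\<omega>. \<lambda>i\<in>{..<k}. V i \<omega>" and ?P = "Pi\<^sub>M {..<k} (\<lambda>_. borel :: (real ^ 'n ^ 'n) measure)"
  let ?now = "\<lambda>\<omega>. \<lambda>i\<in>{k}. V i \<omega>" and ?N = "Pi\<^sub>M {k} (\<lambda>_. borel :: (real ^ 'n ^ 'n) measure)"
  have ind: "indep_var ?N ?now ?P ?past"
    by (rule indep_var_restrict[OF indep]) auto
  have "sets (history k) = {?past -` A \<inter> space M | A. A \<in> sets ?P}"
    unfolding history_def by (rule sets_vimage_algebra2) (auto simp: space_PiM)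
  then have sub_past: "{Y -` A \<inter> space M | A. A \<in> sets borel} \<subseteq> {?past -` A \<inter> space M | A. A \<in> sets ?P}"
    using measurable_sets[OF Y] unfolding space_history by auto
  have sub_now: "{(\<lambda>\<omega>. g (V k \<omega>)) -` A \<inter> space M | A. A \<in> sets borel}
      \<subseteq> {?now -` A \<inter> space M | A. A \<in> sets ?N}"
  proof safe
    fix A :: "real set" assume "A \<in> sets borel"
    have "(\<lambda>f. g (f k)) \<in> borel_measurable ?N"
      using g by (intro measurable_compose[OF measurable_component_singleton]) auto
    from measurable_sets[OF this \<open>A \<in> sets borel\<close>]
    show "\<exists>B. (\<lambda>\<omega>. g (V k \<omega>)) -` A \<inter> space M = ?now -` B \<inter> space M \<and> B \<in> sets ?N"
      by (intro exI[of _ "(\<lambda>f. g (f k)) -` A \<inter> space ?N"]) (auto simp: space_PiM)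
  qed
  show ?thesis
    using ind measurable_history[OF Y] measurable_compose[OF V_measurable g]
      sigma_sets_mono'[OF sub_past, THEN subsetD] sigma_sets_mono'[OF sub_now, THEN subsetD]
    unfolding indep_var_eq indep_set_def
    by (auto elim!: indep_sets_mono_sets split: bool.split)
qed

lemma expectation_mult_history:
  fixes Y :: "'a \<Rightarrow> real"
  assumes Y: "Y \<in> borel_measurable (history k)" "integrable M Y"
    and g: "g \<in> borel_measurable borel" "integrable M (\<lambda>\<omega>. g (V k \<omega>) :: real)"
  shows "expectation (\<lambda>\<omega>. g (V k \<omega>) * Y \<omega>) = expectation (\<lambda>\<omega>. g (V k \<omega>)) * expectation Y"
    and "integrable M (\<lambda>\<omega>. g (V k \<omega>) * Y \<omega>)"
  using indep_var_lebesgue_integral[OF indep_history[OF Y(1) g(1)] g(2) Y(2)]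
    indep_var_integrable[OF indep_history[OF Y(1) g(1)] g(2) Y(2)]
  by auto

section \<open>Random products of the chain and their expectations\<close>

definition T :: "nat \<Rightarrow> nat \<Rightarrow> 'a \<Rightarrow> real ^ 'n ^ 'n" where
  "T s k \<omega> = transition (\<lambda>k. V k \<omega>) s k"

lemma T_Suc: "T s (Suc k) \<omega> $ i $ j = (\<Sum>l\<in>UNIV. V (s + k) \<omega> $ i $ l * T s k \<omega> $ l $ j)"
  unfolding T_def transition_Suc_nth by simp

lemma T_bounds:
  assumes "\<omega> \<in> space M"
  shows "0 \<le> T s k \<omega> $ i $ j" "T s k \<omega> $ i $ j \<le> 1"
  using stochastic_matrixD[OF stochastic_matrix_transition[of "\<lambda>k. V k \<omega>", OF stochastic[OF assms]]]
  unfolding T_def by auto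

text \<open>All factors of \<open>T s k\<close> have indices below \<open>s + k\<close>. This is
  what makes the next factor \<open>V (s + k)\<close> independent of the product.\<close>

lemma T_history: "(\<lambda>\<omega>. T s k \<omega> $ i $ j) \<in> borel_measurable (history (s + k))"
proof (induction k arbitrary: i)
  case 0
  then show ?case by (simp add: T_def)
next
  case (Suc k)
  have [measurable]: "(\<lambda>\<omega>. T s k \<omega> $ l $ j) \<in> borel_measurable (history (s + Suc k))" for l
    using measurable_from_subalg[OF subalgebra_history_Suc Suc.IH] by simp
  have [measurable]: "V (s + k) \<in> borel_measurable (history (s + Suc k))"
    by (rule V_history) simp
  show ?case
    unfolding T_Suc by measurable
qed

lemma T_measurable [measurable]: "(\<lambda>\<omega>. T s k \<omega> $ i $ j) \<in> borel_measurable M"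
  by (rule measurable_history[OF T_history])

lemma integrable_T: "integrable M (\<lambda>\<omega>. T s k \<omega> $ i $ j)"
proof (rule integrable_const_bound[of _ 1])
  show "AE \<omega> in M. norm (T s k \<omega> $ i $ j) \<le> 1"
    using T_bounds by (intro AE_I2) auto
qed (rule T_measurable)

text \<open>Each new factor is independent of the product so far, so the expectation factorizes
  entry by entry.\<close>

lemma expectation_T: "expectation (\<lambda>\<omega>. T s k \<omega> $ i $ j) = transition (expected_chain M V) s k $ i $ j"
proof (induction k arbitrary: i)
  case 0
  then show ?case by (simp add: T_def prob_space)
next
  case (Suc k)
  have mult: "expectation (\<lambda>\<omega>. V (s + k) \<omega> $ i $ l * T s k \<omega> $ l $ j)
      = expectation (\<lambda>\<omega>. V (s + k) \<omega> $ i $ l) * expectation (\<lambda>\<omega>. T s k \<omega> $ l $ j)"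
    "integrable M (\<lambda>\<omega>. V (s + k) \<omega> $ i $ l * T s k \<omega> $ l $ j)" for l
    using expectation_mult_history[OF T_history integrable_T entry_measurable_borel integrable_entry] .
  show ?case
    unfolding T_Suc transition_Suc_nth
    by (simp add: Bochner_Integration.integral_sum mult Suc.IH expected_chain_nth)
qed

lemma tendsto_expectation_bounded:
  fixes X :: "nat \<Rightarrow> 'a \<Rightarrow> real"
  assumes [measurable]: "\<And>k. X k \<in> borel_measurable M"
    and "\<And>k \<omega>. \<omega> \<in> space M \<Longrightarrow> \<bar>X k \<omega>\<bar> \<le> 1"
    and Y [measurable]: "Y \<in> borel_measurable M"
    and "AE \<omega> in M. (\<lambda>k. X k \<omega>) \<longlonglongrightarrow> Y \<omega>"
  shows "(\<lambda>k. expectation (X k)) \<longlonglongrightarrow> expectation Y"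
  using assms by (intro integral_dominated_convergence[where w = "\<lambda>_. 1"]) auto

text \<open>The products of the expected chain are expectations of the random products, whose
  entries are bounded, so almost sure limits pass through the expectation by dominated
  convergence.\<close>

lemma mutually_ergodic_expected_chain:
  assumes "AE \<omega> in M. mutually_ergodic (\<lambda>k. V k \<omega>) i j"
  shows "mutually_ergodic (expected_chain M V) i j"
proof -
  have conv: "convergent (\<lambda>k. transition (expected_chain M V) s k $ r $ l)"
    if r: "AE \<omega> in M. ergodic_index (\<lambda>k. V k \<omega>) r" for r s l
  proof -
    \<comment> \<open>\<open>lim\<close> turns the limit into a random variable; its value where no
      limit exists concerns only a null set.\<close>
    have "AE \<omega> in M. (\<lambda>k. T s k \<omega> $ r $ l) \<longlonglongrightarrow> lim (\<lambda>k. T s k \<omega> $ r $ l)"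
      using r unfolding ergodic_index_iff_transition T_def
      by eventually_elim (auto simp: convergent_LIMSEQ_iff)
    then have "(\<lambda>k. expectation (\<lambda>\<omega>. T s k \<omega> $ r $ l)) \<longlonglongrightarrow> expectation (\<lambda>\<omega>. lim (\<lambda>k. T s k \<omega> $ r $ l))"
      using T_bounds by (intro tendsto_expectation_bounded) auto
    then show ?thesis
      unfolding expectation_T by (auto simp: convergent_def)
  qed
  have "(\<lambda>k. transition (expected_chain M V) s k $ i $ l - transition (expected_chain M V) s k $ j $ l)
      \<longlonglongrightarrow> 0" for s l
  proof -
    have "AE \<omega> in M. (\<lambda>k. T s k \<omega> $ i $ l - T s k \<omega> $ j $ l) \<longlonglongrightarrow> 0"
      using assms unfolding mutually_ergodic_def mutually_weakly_ergodic_iff_transition T_def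
      by eventually_elim auto
    then have "(\<lambda>k. expectation (\<lambda>\<omega>. T s k \<omega> $ i $ l - T s k \<omega> $ j $ l)) \<longlonglongrightarrow> expectation (\<lambda>_. 0)"
    proof (intro tendsto_expectation_bounded)
      fix k \<omega> assume "\<omega> \<in> space M"
      then show "\<bar>T s k \<omega> $ i $ l - T s k \<omega> $ j $ l\<bar> \<le> 1"
        using T_bounds[of \<omega> s k i l] T_bounds[of \<omega> s k j l] by linarith
    qed auto
    then show ?thesis
      by (simp add: integrable_T expectation_T)
  qed
  moreover have "AE \<omega> in M. ergodic_index (\<lambda>k. V k \<omega>) i" "AE \<omega> in M. ergodic_index (\<lambda>k. V k \<omega>) j"
    using assms unfolding mutually_ergodic_def by (auto elim: eventually_mono)
  ultimately show ?thesis
    unfolding mutually_ergodic_def mutually_weakly_ergodic_iff_transition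
    using conv ergodic_index_iff_transition by blast
qed

text \<open>Both directions are of Borel-Cantelli type: summable expectations make the flow summable
  almost surely, and otherwise the independence of the flows at different times makes it diverge
  almost surely.\<close>

lemma AE_not_summable_flow_iff:
  "(AE \<omega> in M. \<not> summable (\<lambda>k. V k \<omega> $ i $ j + V k \<omega> $ j $ i)) \<longleftrightarrow>
     \<not> summable (\<lambda>k. expected_chain M V k $ i $ j + expected_chain M V k $ j $ i)"
proof -
  let ?X = "\<lambda>k \<omega>. V k \<omega> $ i $ j + V k \<omega> $ j $ i"
  have E: "expectation (?X k) = expected_chain M V k $ i $ j + expected_chain M V k $ j $ i" for k
    by (simp add: expected_chain_nth integrable_entry)
  have X: "0 \<le> ?X k \<omega>" "?X k \<omega> \<le> 2" if "\<omega> \<in> space M" for k \<omega>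
    using entry_bounds(1,2)[OF that, of k i j] entry_bounds(1,2)[OF that, of k j i] by auto
  show ?thesis
  proof
    assume *: "AE \<omega> in M. \<not> summable (\<lambda>k. ?X k \<omega>)"
    show "\<not> summable (\<lambda>k. expected_chain M V k $ i $ j + expected_chain M V k $ j $ i)"
    proof
      assume "summable (\<lambda>k. expected_chain M V k $ i $ j + expected_chain M V k $ j $ i)"
      then have "summable (\<lambda>k. expectation (?X k))"
        by (simp only: E)
      moreover have "integrable M (?X k)" for k
        by (intro Bochner_Integration.integrable_add integrable_entry)
      ultimately have "AE \<omega> in M. summable (\<lambda>k. ?X k \<omega>)"
        using X(1) by (intro AE_summable_if_summable_integral)
      with * have "AE \<omega> in M. False"
        by eventually_elim simp
      then show False by simp
    qed
  next
    assume "\<not> summable (\<lambda>k. expected_chain M V k $ i $ j + expected_chain M V k $ j $ i)"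
    moreover have "indep_vars (\<lambda>_. borel) ?X UNIV"
      by (rule indep_vars_compose2[OF indep, where Y = "\<lambda>_ A. A $ i $ j + A $ j $ i"]) measurable
    ultimately show "AE \<omega> in M. \<not> summable (\<lambda>k. ?X k \<omega>)"
      using X by (intro AE_not_summable_if_indep) (auto simp only: E)
  qed
qed

text \<open>An edge is an unordered pair and the flow is symmetric in \<open>i\<close> and
  \<open>j\<close>, so both ways of writing the pair give the same condition.\<close>

lemma infinite_flow_graph_iff:
  "{i, j} \<in> infinite_flow_graph M V \<longleftrightarrow>
     i \<noteq> j \<and> (AE \<omega> in M. \<not> summable (\<lambda>k. V k \<omega> $ i $ j + V k \<omega> $ j $ i))"
proof -
  have inf: "(AE \<omega> in M. (\<Sum>k. ennreal (V k \<omega> $ i $ j + V k \<omega> $ j $ i)) = \<infinity>) \<longleftrightarrow>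
      (AE \<omega> in M. \<not> summable (\<lambda>k. V k \<omega> $ i $ j + V k \<omega> $ j $ i))" for i j
    by (rule AE_cong) (intro suminf_ennreal_eq_infinity_iff add_nonneg_nonneg entry_bounds(1))
  show ?thesis
    unfolding infinite_flow_graph_def mem_Collect_eq inf doubleton_eq_iff
    by (auto simp: add.commute)
qed

lemma infinite_flow_graph_expected_iff:
  "{i, j} \<in> infinite_flow_graph M (\<lambda>k _. expected_chain M V k) \<longleftrightarrow>
     i \<noteq> j \<and> \<not> summable (\<lambda>k. expected_chain M V k $ i $ j + expected_chain M V k $ j $ i)"
proof -
  have inf: "(\<Sum>k. ennreal (expected_chain M V k $ i $ j + expected_chain M V k $ j $ i)) = \<infinity> \<longleftrightarrow>
      \<not> summable (\<lambda>k. expected_chain M V k $ i $ j + expected_chain M V k $ j $ i)" for i j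
    using stochastic_matrixD(1)[OF stochastic_expected_chain]
    by (intro suminf_ennreal_eq_infinity_iff add_nonneg_nonneg)
  show ?thesis
    unfolding infinite_flow_graph_def mem_Collect_eq inf doubleton_eq_iff
    by (auto simp: add.commute)
qed

end

subsection \<open>Chains with a common steady state and weak feedback\<close>

text \<open>Jensen's inequality for powers. Odd powers are in general convex only on the nonnegative
  half line, where the values \<open>x l\<close> lie.\<close>

lemma convex_combination_power_le:
  fixes v x :: "'n :: finite \<Rightarrow> real"
  assumes "\<And>l. 0 \<le> v l" "(\<Sum>l\<in>UNIV. v l) = 1" "\<And>l. 0 \<le> x l"
  shows "(\<Sum>l\<in>UNIV. v l * x l) ^ p \<le> (\<Sum>l\<in>UNIV. v l * x l ^ p)"
proof -
  have "convex_on {0::real..} (\<lambda>x. x ^ p)"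
    by (cases "even p") (auto intro: convex_power_odd convex_on_subset[OF convex_power_even])
  from convex_on_sum[OF _ _ this, of UNIV v x] assms show ?thesis
    by simp
qed

text \<open>The variance of \<open>x\<close> under the weights \<open>v\<close> is half the double
  sum of \<open>v l * v r * (x l - x r)^2\<close>; of these nonnegative terms the one at
  \<open>(a, b)\<close> is kept. For \<open>a = b\<close> this is Jensen's inequality for
  squares.\<close>

lemma convex_combination_variance:
  fixes v x :: "'n :: finite \<Rightarrow> real"
  assumes v: "\<And>l. 0 \<le> v l" "(\<Sum>l\<in>UNIV. v l) = 1"
  shows "(\<Sum>l\<in>UNIV. v l * x l)\<^sup>2 + v a * v b * (x a - x b)\<^sup>2 / 2 \<le> (\<Sum>l\<in>UNIV. v l * (x l)\<^sup>2)"
proof -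
  let ?m = "\<Sum>l\<in>UNIV. v l * x l" and ?q = "\<Sum>l\<in>UNIV. v l * (x l)\<^sup>2"
  have "(\<Sum>r\<in>UNIV. v l * v r * (x l - x r)\<^sup>2)
      = v l * (x l)\<^sup>2 - 2 * (v l * x l) * ?m + v l * ?q" for l
  proof -
    have "(\<Sum>r\<in>UNIV. v l * v r * (x l - x r)\<^sup>2)
        = (\<Sum>r\<in>UNIV. v l * (x l)\<^sup>2 * v r - 2 * (v l * x l) * (v r * x r) + v l * (v r * (x r)\<^sup>2))"
      by (intro sum.cong refl) (simp add: power2_eq_square algebra_simps)
    also have "\<dots> = v l * (x l)\<^sup>2 * (\<Sum>r\<in>UNIV. v r) - 2 * (v l * x l) * ?m + v l * ?q"
      by (simp only: sum.distrib sum_subtractf sum_distrib_left)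
    finally show ?thesis by (simp add: v(2))
  qed
  then have "(\<Sum>l\<in>UNIV. \<Sum>r\<in>UNIV. v l * v r * (x l - x r)\<^sup>2)
      = ?q - (\<Sum>l\<in>UNIV. 2 * (v l * x l)) * ?m + (\<Sum>l\<in>UNIV. v l) * ?q"
    by (simp only: sum.distrib sum_subtractf sum_distrib_right)
  also have "\<dots> = 2 * ?q - 2 * ?m\<^sup>2"
    by (simp add: v(2) sum_distrib_left[symmetric] power2_eq_square)
  finally have "(\<Sum>l\<in>UNIV. \<Sum>r\<in>UNIV. v l * v r * (x l - x r)\<^sup>2) = 2 * ?q - 2 * ?m\<^sup>2" .
  moreover have "v a * v b * (x a - x b)\<^sup>2 \<le> (\<Sum>r\<in>UNIV. v a * v r * (x a - x r)\<^sup>2)"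
    using v(1) by (intro member_le_sum[of b UNIV "\<lambda>r. v a * v r * (x a - x r)\<^sup>2"]) auto
  moreover have "\<dots> \<le> (\<Sum>l\<in>UNIV. \<Sum>r\<in>UNIV. v l * v r * (x l - x r)\<^sup>2)"
    using v(1) by (intro member_le_sum[of a UNIV "\<lambda>l. \<Sum>r\<in>UNIV. v l * v r * (x l - x r)\<^sup>2"])
      (auto intro!: sum_nonneg)
  ultimately show ?thesis by linarith
qed

text \<open>If the limit \<open>L\<close> were nonzero, \<open>(d k)^2\<close> would eventually
  exceed \<open>L^2 / 2\<close>, and \<open>c\<close> would be dominated by a multiple of the
  summable series.\<close>

lemma tendsto_zero_if_summable_weighted_square:
  fixes c d :: "nat \<Rightarrow> real"
  assumes "summable (\<lambda>k. c k * (d k)\<^sup>2)" "\<And>k. 0 \<le> c k" "\<not> summable c" "convergent d"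
  shows "d \<longlonglongrightarrow> 0"
proof -
  obtain L where L: "d \<longlonglongrightarrow> L"
    using assms(4) unfolding convergent_def by blast
  have "L = 0"
  proof (rule ccontr)
    assume "L \<noteq> 0"
    have "(\<lambda>k. (d k)\<^sup>2) \<longlonglongrightarrow> L\<^sup>2"
      by (intro tendsto_intros L)
    moreover have "L\<^sup>2 / 2 < L\<^sup>2"
      using \<open>L \<noteq> 0\<close> by simp
    ultimately have "\<forall>\<^sub>F k in sequentially. L\<^sup>2 / 2 < (d k)\<^sup>2"
      by (rule order_tendstoD(1))
    then have "\<forall>\<^sub>F k in sequentially. norm (c k) \<le> c k * (d k)\<^sup>2 * (2 / L\<^sup>2)"
    proof (rule eventually_mono)
      fix k assume "L\<^sup>2 / 2 < (d k)\<^sup>2"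
      then have "1 \<le> (d k)\<^sup>2 * (2 / L\<^sup>2)"
        using \<open>L \<noteq> 0\<close> by (simp add: field_simps)
      then show "norm (c k) \<le> c k * (d k)\<^sup>2 * (2 / L\<^sup>2)"
        using mult_left_mono[of 1 "(d k)\<^sup>2 * (2 / L\<^sup>2)" "c k"] assms(2)[of k] by (simp add: mult.assoc)
    qed
    then have "summable c"
      by (rule summable_comparison_test_ev) (intro summable_mult2 assms(1))
    with assms(3) show False by contradiction
  qed
  with L show ?thesis by simp
qed

text \<open>Steady state and feedback are written out by entries, the inner product of columns as a
  sum over rows, because the inequalities below are applied row by row.\<close>

locale steady_feedback_chain = independent_chain M V
  for M :: "'a measure" and V :: "nat \<Rightarrow> 'a \<Rightarrow> real ^ 'n ^ 'n" +
  fixes \<pi> :: "real ^ 'n" and \<gamma> :: real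
  assumes pos: "\<And>i. 0 < \<pi> $ i"
    and steady: "\<And>k j. (\<Sum>i\<in>UNIV. \<pi> $ i * expectation (\<lambda>\<omega>. V k \<omega> $ i $ j)) = \<pi> $ j"
    and \<gamma>_pos: "0 < \<gamma>"
    and feedback: "\<And>k i j. i \<noteq> j \<Longrightarrow>
      \<gamma> * (expectation (\<lambda>\<omega>. V k \<omega> $ i $ j) + expectation (\<lambda>\<omega>. V k \<omega> $ j $ i))
      \<le> (\<Sum>l\<in>UNIV. expectation (\<lambda>\<omega>. V k \<omega> $ l $ i * V k \<omega> $ l $ j))"
begin

section \<open>Supermartingales from the steady state and decrease of the energy\<close>

lemma integrable_T_power: "integrable M (\<lambda>\<omega>. T s k \<omega> $ i $ j ^ p)"
proof (rule integrable_const_bound[of _ 1])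
  show "AE \<omega> in M. norm (T s k \<omega> $ i $ j ^ p) \<le> 1"
    using T_bounds by (intro AE_I2) (simp add: power_le_one)
  show "(\<lambda>\<omega>. T s k \<omega> $ i $ j ^ p) \<in> borel_measurable M"
    by (intro borel_measurable_power T_measurable)
qed

text \<open>The matrix at time \<open>k\<close> is independent of the past quantities
  \<open>Y l\<close>, so its entries may be replaced by their expectations; the steady state then
  collapses the sum over \<open>i\<close> to \<open>\<pi> $ l\<close>.\<close>

lemma expectation_steady:
  assumes Y: "\<And>l. Y l \<in> borel_measurable (history k)" "\<And>l. integrable M (Y l)"
  shows "expectation (\<lambda>\<omega>. \<Sum>l\<in>UNIV. \<Sum>i\<in>UNIV. \<pi> $ i * (V k \<omega> $ i $ l * Y l \<omega>))
      = (\<Sum>l\<in>UNIV. \<pi> $ l * expectation (Y l))"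
    and "integrable M (\<lambda>\<omega>. \<Sum>l\<in>UNIV. \<Sum>i\<in>UNIV. \<pi> $ i * (V k \<omega> $ i $ l * Y l \<omega>))"
proof -
  have mult: "expectation (\<lambda>\<omega>. V k \<omega> $ i $ l * Y l \<omega>)
      = expectation (\<lambda>\<omega>. V k \<omega> $ i $ l) * expectation (Y l)"
    "integrable M (\<lambda>\<omega>. V k \<omega> $ i $ l * Y l \<omega>)" for i l
    using expectation_mult_history[OF Y entry_measurable_borel integrable_entry] .
  show "integrable M (\<lambda>\<omega>. \<Sum>l\<in>UNIV. \<Sum>i\<in>UNIV. \<pi> $ i * (V k \<omega> $ i $ l * Y l \<omega>))"
    by (intro Bochner_Integration.integrable_sum integrable_mult_right mult)
  have "expectation (\<lambda>\<omega>. \<Sum>l\<in>UNIV. \<Sum>i\<in>UNIV. \<pi> $ i * (V k \<omega> $ i $ l * Y l \<omega>))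
      = (\<Sum>l\<in>UNIV. (\<Sum>i\<in>UNIV. \<pi> $ i * expectation (\<lambda>\<omega>. V k \<omega> $ i $ l)) * expectation (Y l))"
    by (simp add: mult sum_distrib_right mult.assoc)
  then show "expectation (\<lambda>\<omega>. \<Sum>l\<in>UNIV. \<Sum>i\<in>UNIV. \<pi> $ i * (V k \<omega> $ i $ l * Y l \<omega>))
      = (\<Sum>l\<in>UNIV. \<pi> $ l * expectation (Y l))"
    by (simp add: steady)
qed

text \<open>Jensen's inequality in each row bounds the next power sum by averages of the current
  powers. Weighted by \<open>\<pi>\<close>, these averages have the same expectation on a past event
  as the current power sum.\<close>

lemma power_sum_supermartingale:
  "bounded_supermartingale M (\<lambda>k. history (s + k))
     (\<lambda>k \<omega>. \<Sum>i\<in>UNIV. \<pi> $ i * T s k \<omega> $ i $ j ^ p) (\<Sum>i\<in>UNIV. \<pi> $ i)"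
proof unfold_locales
  fix k
  show "subalgebra M (history (s + k))"
    by (rule subalgebra_M_history)
  show "subalgebra (history (s + Suc k)) (history (s + k))"
    using subalgebra_history_Suc by simp
  show "(\<lambda>\<omega>. \<Sum>i\<in>UNIV. \<pi> $ i * T s k \<omega> $ i $ j ^ p) \<in> borel_measurable (history (s + k))"
    by (intro borel_measurable_sum borel_measurable_times borel_measurable_power T_history) auto
  fix \<omega> assume \<omega>: "\<omega> \<in> space M"
  show "0 \<le> (\<Sum>i\<in>UNIV. \<pi> $ i * T s k \<omega> $ i $ j ^ p)"
    by (intro sum_nonneg mult_nonneg_nonneg zero_le_power T_bounds \<omega> less_imp_le[OF pos])
  show "(\<Sum>i\<in>UNIV. \<pi> $ i * T s k \<omega> $ i $ j ^ p) \<le> (\<Sum>i\<in>UNIV. \<pi> $ i)"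
    by (intro sum_mono mult_left_le power_le_one T_bounds \<omega> less_imp_le[OF pos])
next
  fix k A assume A: "A \<in> sets (history (s + k))"
  then have AM: "A \<in> sets M"
    using subalgebra_M_history unfolding subalgebra_def by blast
  \<comment> \<open>The indicator of the past event is absorbed into \<open>Y\<close>, which stays
    measurable in the history, so \<open>expectation_steady\<close> applies to it.\<close>
  define Y where "Y l \<omega> = indicator A \<omega> * T s k \<omega> $ l $ j ^ p" for l \<omega>
  have Y_hist: "Y l \<in> borel_measurable (history (s + k))" for l
    unfolding Y_def using A
    by (intro borel_measurable_times borel_measurable_power borel_measurable_indicator T_history)
  have ind_int: "integrable M (\<lambda>\<omega>. indicator A \<omega> * T s r \<omega> $ l $ j ^ p)" for r l
    using integrable_real_mult_indicator[OF AM integrable_T_power] by (simp add: mult.commute)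
  have Y_int: "integrable M (Y l)" for l
    unfolding Y_def by (rule ind_int)
  have "(\<integral>\<omega>. indicator A \<omega> * (\<Sum>i\<in>UNIV. \<pi> $ i * T s (Suc k) \<omega> $ i $ j ^ p) \<partial>M)
      \<le> (\<integral>\<omega>. (\<Sum>l\<in>UNIV. \<Sum>i\<in>UNIV. \<pi> $ i * (V (s + k) \<omega> $ i $ l * Y l \<omega>)) \<partial>M)"
  proof (rule integral_mono[OF _ expectation_steady(2)[OF Y_hist Y_int]])
    have "integrable M (\<lambda>\<omega>. \<Sum>i\<in>UNIV. \<pi> $ i * (indicator A \<omega> * T s (Suc k) \<omega> $ i $ j ^ p))"
      by (intro Bochner_Integration.integrable_sum integrable_mult_right ind_int)
    then show "integrable M (\<lambda>\<omega>. indicator A \<omega> * (\<Sum>i\<in>UNIV. \<pi> $ i * T s (Suc k) \<omega> $ i $ j ^ p))"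
      by (simp add: sum_distrib_left mult.left_commute)
    fix \<omega> assume \<omega>: "\<omega> \<in> space M"
    have "(\<Sum>i\<in>UNIV. \<pi> $ i * T s (Suc k) \<omega> $ i $ j ^ p)
        \<le> (\<Sum>i\<in>UNIV. \<pi> $ i * (\<Sum>l\<in>UNIV. V (s + k) \<omega> $ i $ l * T s k \<omega> $ l $ j ^ p))"
      unfolding T_Suc
      by (intro sum_mono mult_left_mono convex_combination_power_le entry_bounds T_bounds \<omega>
          less_imp_le[OF pos])
    then have "indicator A \<omega> * (\<Sum>i\<in>UNIV. \<pi> $ i * T s (Suc k) \<omega> $ i $ j ^ p)
        \<le> indicator A \<omega> * (\<Sum>i\<in>UNIV. \<pi> $ i * (\<Sum>l\<in>UNIV. V (s + k) \<omega> $ i $ l * T s k \<omega> $ l $ j ^ p))"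
      by (intro mult_left_mono) auto
    also have "\<dots> = (\<Sum>l\<in>UNIV. \<Sum>i\<in>UNIV. \<pi> $ i * (V (s + k) \<omega> $ i $ l * Y l \<omega>))"
      unfolding Y_def sum_distrib_left by (subst sum.swap) (simp add: mult_ac)
    finally show "indicator A \<omega> * (\<Sum>i\<in>UNIV. \<pi> $ i * T s (Suc k) \<omega> $ i $ j ^ p)
        \<le> (\<Sum>l\<in>UNIV. \<Sum>i\<in>UNIV. \<pi> $ i * (V (s + k) \<omega> $ i $ l * Y l \<omega>))" .
  qed
  also have "\<dots> = (\<Sum>l\<in>UNIV. \<pi> $ l * expectation (Y l))"
    by (rule expectation_steady(1)[OF Y_hist Y_int])
  also have "\<dots> = expectation (\<lambda>\<omega>. \<Sum>l\<in>UNIV. \<pi> $ l * Y l \<omega>)"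
    using Y_int by simp
  also have "\<dots> = (\<integral>\<omega>. indicator A \<omega> * (\<Sum>i\<in>UNIV. \<pi> $ i * T s k \<omega> $ i $ j ^ p) \<partial>M)"
    unfolding Y_def by (simp add: sum_distrib_left mult.left_commute)
  finally show "(\<integral>\<omega>. indicator A \<omega> * (\<Sum>i\<in>UNIV. \<pi> $ i * T s (Suc k) \<omega> $ i $ j ^ p) \<partial>M)
      \<le> (\<integral>\<omega>. indicator A \<omega> * (\<Sum>i\<in>UNIV. \<pi> $ i * T s k \<omega> $ i $ j ^ p) \<partial>M)" .
qed

text \<open>A quadratic Lyapunov function for column \<open>j\<close> of the products.\<close>

definition energy :: "nat \<Rightarrow> 'n \<Rightarrow> nat \<Rightarrow> real" where
  "energy s j k = (\<Sum>i\<in>UNIV. \<pi> $ i * expectation (\<lambda>\<omega>. (T s k \<omega> $ i $ j)\<^sup>2))"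

lemma energy_nonneg: "0 \<le> energy s j k"
  unfolding energy_def
  by (intro sum_nonneg mult_nonneg_nonneg less_imp_le[OF pos] integral_nonneg_AE AE_I2) auto

text \<open>The variance inequality is applied in each row to the pair \<open>a\<close>,
  \<open>b\<close> and weighted by \<open>\<pi>\<close>. The squared difference belongs to the past,
  so its expectation splits off, and the averaged squares reproduce the old energy by the steady
  state.\<close>

lemma energy_decrease:
  "energy s j (Suc k) + (\<Sum>i\<in>UNIV. \<pi> $ i * expectation (\<lambda>\<omega>. V (s + k) \<omega> $ i $ a * V (s + k) \<omega> $ i $ b))
      * expectation (\<lambda>\<omega>. (T s k \<omega> $ a $ j - T s k \<omega> $ b $ j)\<^sup>2) / 2 \<le> energy s j k"
proof -
  let ?D = "\<lambda>\<omega>. (T s k \<omega> $ a $ j - T s k \<omega> $ b $ j)\<^sup>2"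
  let ?P = "\<lambda>i A :: real ^ 'n ^ 'n. A $ i $ a * A $ i $ b"
  have D_hist: "?D \<in> borel_measurable (history (s + k))"
    by (intro borel_measurable_power borel_measurable_diff T_history)
  have D_int: "integrable M ?D"
  proof (rule integrable_const_bound[of _ 1])
    show "AE \<omega> in M. norm (?D \<omega>) \<le> 1"
    proof (rule AE_I2)
      fix \<omega> assume "\<omega> \<in> space M"
      then have "\<bar>T s k \<omega> $ a $ j - T s k \<omega> $ b $ j\<bar> \<le> 1"
        using T_bounds[of \<omega> s k a j] T_bounds[of \<omega> s k b j] by linarith
      then show "norm (?D \<omega>) \<le> 1"
        by (simp add: abs_square_le_1)
    qed
  qed (rule measurable_history[OF D_hist])
  have P_meas: "?P i \<in> borel_measurable borel" for i
    by (intro borel_measurable_times entry_measurable_borel)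
  have P_int: "integrable M (\<lambda>\<omega>. ?P i (V (s + k) \<omega>))" for i
  proof (rule integrable_const_bound[of _ 1])
    show "AE \<omega> in M. norm (?P i (V (s + k) \<omega>)) \<le> 1"
      using entry_bounds by (intro AE_I2) (simp add: mult_le_one)
  qed (rule measurable_compose[OF V_measurable P_meas])
  have PD: "expectation (\<lambda>\<omega>. ?P i (V (s + k) \<omega>) * ?D \<omega>)
      = expectation (\<lambda>\<omega>. ?P i (V (s + k) \<omega>)) * expectation ?D"
    "integrable M (\<lambda>\<omega>. ?P i (V (s + k) \<omega>) * ?D \<omega>)" for i
    using expectation_mult_history[OF D_hist D_int P_meas P_int] .
  have sq_hist: "(\<lambda>\<omega>. (T s k \<omega> $ l $ j)\<^sup>2) \<in> borel_measurable (history (s + k))" for l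
    by (intro borel_measurable_power T_history)
  have "expectation (\<lambda>\<omega>. \<Sum>i\<in>UNIV. \<pi> $ i * (T s (Suc k) \<omega> $ i $ j)\<^sup>2
        + \<pi> $ i * (?P i (V (s + k) \<omega>) * ?D \<omega>) / 2)
      \<le> expectation (\<lambda>\<omega>. \<Sum>l\<in>UNIV. \<Sum>i\<in>UNIV. \<pi> $ i * (V (s + k) \<omega> $ i $ l * (T s k \<omega> $ l $ j)\<^sup>2))"
  proof (rule integral_mono[OF _ expectation_steady(2)[OF sq_hist integrable_T_power]])
    show "integrable M (\<lambda>\<omega>. \<Sum>i\<in>UNIV. \<pi> $ i * (T s (Suc k) \<omega> $ i $ j)\<^sup>2
        + \<pi> $ i * (?P i (V (s + k) \<omega>) * ?D \<omega>) / 2)"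
      by (intro Bochner_Integration.integrable_sum Bochner_Integration.integrable_add
          integrable_mult_right integrable_divide integrable_T_power PD)
    fix \<omega> assume \<omega>: "\<omega> \<in> space M"
    have "(\<Sum>i\<in>UNIV. \<pi> $ i * (T s (Suc k) \<omega> $ i $ j)\<^sup>2 + \<pi> $ i * (?P i (V (s + k) \<omega>) * ?D \<omega>) / 2)
        = (\<Sum>i\<in>UNIV. \<pi> $ i * ((\<Sum>l\<in>UNIV. V (s + k) \<omega> $ i $ l * T s k \<omega> $ l $ j)\<^sup>2
          + V (s + k) \<omega> $ i $ a * V (s + k) \<omega> $ i $ b * ?D \<omega> / 2))"
      unfolding T_Suc by (simp add: distrib_left)
    also have "\<dots> \<le> (\<Sum>i\<in>UNIV. \<pi> $ i * (\<Sum>l\<in>UNIV. V (s + k) \<omega> $ i $ l * (T s k \<omega> $ l $ j)\<^sup>2))"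
      by (intro sum_mono mult_left_mono convex_combination_variance entry_bounds \<omega> less_imp_le[OF pos])
    also have "\<dots> = (\<Sum>l\<in>UNIV. \<Sum>i\<in>UNIV. \<pi> $ i * (V (s + k) \<omega> $ i $ l * (T s k \<omega> $ l $ j)\<^sup>2))"
      unfolding sum_distrib_left by (rule sum.swap)
    finally show "(\<Sum>i\<in>UNIV. \<pi> $ i * (T s (Suc k) \<omega> $ i $ j)\<^sup>2
        + \<pi> $ i * (?P i (V (s + k) \<omega>) * ?D \<omega>) / 2)
        \<le> (\<Sum>l\<in>UNIV. \<Sum>i\<in>UNIV. \<pi> $ i * (V (s + k) \<omega> $ i $ l * (T s k \<omega> $ l $ j)\<^sup>2))" .
  qed
  also have "\<dots> = energy s j k"
    unfolding energy_def by (rule expectation_steady(1)[OF sq_hist integrable_T_power])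
  also have "expectation (\<lambda>\<omega>. \<Sum>i\<in>UNIV. \<pi> $ i * (T s (Suc k) \<omega> $ i $ j)\<^sup>2
        + \<pi> $ i * (?P i (V (s + k) \<omega>) * ?D \<omega>) / 2)
      = energy s j (Suc k) + (\<Sum>i\<in>UNIV. \<pi> $ i * expectation (\<lambda>\<omega>. ?P i (V (s + k) \<omega>)))
        * expectation ?D / 2"
  proof -
    have int: "integrable M (\<lambda>\<omega>. \<pi> $ i * (T s (Suc k) \<omega> $ i $ j)\<^sup>2)"
      "integrable M (\<lambda>\<omega>. \<pi> $ i * (?P i (V (s + k) \<omega>) * ?D \<omega>) / 2)" for i
      by (intro integrable_mult_right integrable_divide integrable_T_power PD)+
    have "expectation (\<lambda>\<omega>. \<Sum>i\<in>UNIV. \<pi> $ i * (T s (Suc k) \<omega> $ i $ j)\<^sup>2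
        + \<pi> $ i * (?P i (V (s + k) \<omega>) * ?D \<omega>) / 2)
      = (\<Sum>i\<in>UNIV. expectation (\<lambda>\<omega>. \<pi> $ i * (T s (Suc k) \<omega> $ i $ j)\<^sup>2
        + \<pi> $ i * (?P i (V (s + k) \<omega>) * ?D \<omega>) / 2))"
      by (rule Bochner_Integration.integral_sum) (rule Bochner_Integration.integrable_add[OF int])
    also have "\<dots> = (\<Sum>i\<in>UNIV. \<pi> $ i * expectation (\<lambda>\<omega>. (T s (Suc k) \<omega> $ i $ j)\<^sup>2)
        + \<pi> $ i * (expectation (\<lambda>\<omega>. ?P i (V (s + k) \<omega>)) * expectation ?D) / 2)"
      by (simp only: Bochner_Integration.integral_add[OF int] integral_divide_zero
          integral_mult_right_zero PD(1))
    also have "\<dots> = energy s j (Suc k)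
        + (\<Sum>i\<in>UNIV. \<pi> $ i * expectation (\<lambda>\<omega>. ?P i (V (s + k) \<omega>))) * expectation ?D / 2"
      unfolding energy_def
      by (simp only: sum.distrib sum_distrib_right sum_divide_distrib mult.assoc)
    finally show ?thesis .
  qed
  finally show ?thesis .
qed

text \<open>Weak feedback bounds the energy loss of each step from below by a multiple of the
  expected summand. The energy is nonnegative, so the telescoping losses have a bounded total, and
  summable expectations give almost sure summability.\<close>

lemma AE_summable_flow:
  "AE \<omega> in M. summable (\<lambda>k. (V (s + k) \<omega> $ a $ b + V (s + k) \<omega> $ b $ a)
     * (T s k \<omega> $ a $ j - T s k \<omega> $ b $ j)\<^sup>2)"
proof (cases "a = b")
  case True
  then show ?thesis by simp
next
  case False
  let ?D = "\<lambda>k \<omega>. (T s k \<omega> $ a $ j - T s k \<omega> $ b $ j)\<^sup>2"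
  let ?F = "\<lambda>A :: real ^ 'n ^ 'n. A $ a $ b + A $ b $ a"
  let ?f = "\<lambda>k \<omega>. ?F (V (s + k) \<omega>) * ?D k \<omega>"
  \<comment> \<open>The minimum of \<open>\<pi>\<close> replaces the weights,
    \<open>\<gamma>\<close> comes from the feedback and the factor \<open>1 / 2\<close> from the
    variance inequality.\<close>
  define c where "c = Min (range (($) \<pi>)) * \<gamma> / 2"
  have Min_le: "Min (range (($) \<pi>)) \<le> \<pi> $ i" for i
    by (intro Min_le) auto
  have Min_pos: "0 < Min (range (($) \<pi>))"
    using pos by (subst Min_gr_iff) auto
  have "0 < c"
    using Min_pos \<gamma>_pos by (simp add: c_def)
  have D_hist: "?D k \<in> borel_measurable (history (s + k))" for k
    by (intro borel_measurable_power borel_measurable_diff T_history)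
  have D_int: "integrable M (?D k)" for k
  proof (rule integrable_const_bound[of _ 1])
    show "AE \<omega> in M. norm (?D k \<omega>) \<le> 1"
    proof (rule AE_I2)
      fix \<omega> assume "\<omega> \<in> space M"
      then have "\<bar>T s k \<omega> $ a $ j - T s k \<omega> $ b $ j\<bar> \<le> 1"
        using T_bounds[of \<omega> s k a j] T_bounds[of \<omega> s k b j] by linarith
      then show "norm (?D k \<omega>) \<le> 1"
        by (simp add: abs_square_le_1)
    qed
  qed (rule measurable_history[OF D_hist])
  have F_int: "integrable M (\<lambda>\<omega>. ?F (V k \<omega>))" for k
    by (intro Bochner_Integration.integrable_add integrable_entry)
  have F_meas: "?F \<in> borel_measurable borel"
    by (intro borel_measurable_add entry_measurable_borel)
  have f: "expectation (?f k) = expectation (\<lambda>\<omega>. ?F (V (s + k) \<omega>)) * expectation (?D k)"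
    "integrable M (?f k)" for k
    using expectation_mult_history[OF D_hist D_int F_meas F_int] .
  have f0: "0 \<le> ?f k \<omega>" if "\<omega> \<in> space M" for k \<omega>
    by (intro mult_nonneg_nonneg add_nonneg_nonneg entry_bounds(1)[OF that]) simp
  have step: "c * expectation (?f k) \<le> energy s j k - energy s j (Suc k)" for k
  proof -
    let ?E = "\<lambda>i. expectation (\<lambda>\<omega>. V (s + k) \<omega> $ i $ a * V (s + k) \<omega> $ i $ b)"
    have E0: "0 \<le> ?E i" for i
      by (intro integral_nonneg_AE AE_I2 mult_nonneg_nonneg entry_bounds(1))
    have "Min (range (($) \<pi>)) * (\<gamma> * expectation (\<lambda>\<omega>. ?F (V (s + k) \<omega>)))
        \<le> Min (range (($) \<pi>)) * (\<Sum>i\<in>UNIV. ?E i)"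
      using feedback[OF False, of "s + k"]
      by (intro mult_left_mono less_imp_le[OF Min_pos]) (simp add: integrable_entry)
    also have "\<dots> \<le> (\<Sum>i\<in>UNIV. \<pi> $ i * ?E i)"
      unfolding sum_distrib_left by (intro sum_mono mult_right_mono Min_le E0)
    finally have "Min (range (($) \<pi>)) * (\<gamma> * expectation (\<lambda>\<omega>. ?F (V (s + k) \<omega>))) * expectation (?D k)
        \<le> (\<Sum>i\<in>UNIV. \<pi> $ i * ?E i) * expectation (?D k)"
      by (intro mult_right_mono integral_nonneg_AE AE_I2) auto
    moreover have "c * expectation (?f k) = Min (range (($) \<pi>)) * (\<gamma> * expectation (\<lambda>\<omega>. ?F (V (s + k) \<omega>)))
        * expectation (?D k) / 2"
      unfolding c_def f(1) by simp
    ultimately show ?thesis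
      using energy_decrease[of s j k a b] by linarith
  qed
  have "summable (\<lambda>k. expectation (?f k))"
  proof (rule summableI_nonneg_bounded)
    show "0 \<le> expectation (?f k)" for k
      by (intro integral_nonneg_AE AE_I2 f0)
    fix n
    have "c * (\<Sum>k<n. expectation (?f k)) \<le> (\<Sum>k<n. energy s j k - energy s j (Suc k))"
      unfolding sum_distrib_left by (intro sum_mono step)
    also have "\<dots> = energy s j 0 - energy s j n"
      by (rule sum_lessThan_telescope')
    finally have "c * (\<Sum>k<n. expectation (?f k)) \<le> energy s j 0"
      using energy_nonneg[of s j n] by linarith
    then show "(\<Sum>k<n. expectation (?f k)) \<le> energy s j 0 / c"
      using \<open>0 < c\<close> by (simp add: pos_le_divide_eq mult.commute)
  qed
  then show ?thesis
    using f(2) f0 by (intro AE_summable_if_summable_integral)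
qed

text \<open>Supermartingale convergence handles the power sums and the summable flow terms make the
  increments vanish; \<open>convergent_if_power_sums_converge\<close> then applies to each column
  and start time, of which there are countably many.\<close>

lemma AE_stable: "AE \<omega> in M. stable_chain (\<lambda>k. V k \<omega>)"
proof -
  have "AE \<omega> in M. \<forall>i. convergent (\<lambda>k. T s k \<omega> $ i $ j)" for s j
  proof -
    have "AE \<omega> in M. \<forall>p. convergent (\<lambda>k. \<Sum>i\<in>UNIV. \<pi> $ i * T s k \<omega> $ i $ j ^ p)"
      unfolding AE_all_countable
      by (intro allI bounded_supermartingale.AE_convergent[OF power_sum_supermartingale])
    moreover have "AE \<omega> in M. \<forall>a b. summable (\<lambda>k. (V (s + k) \<omega> $ a $ b + V (s + k) \<omega> $ b $ a)
        * (T s k \<omega> $ a $ j - T s k \<omega> $ b $ j)\<^sup>2)"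
      by (intro eventually_all_finite AE_summable_flow)
    ultimately show ?thesis
      using AE_space
    proof eventually_elim
      case (elim \<omega>)
      note \<omega> = elim(3)
      have inc: "(\<lambda>k. T s (Suc k) \<omega> $ i $ j - T s k \<omega> $ i $ j) \<longlonglongrightarrow> 0" for i
      proof -
        let ?g = "\<lambda>k. \<Sum>l\<in>UNIV. (V (s + k) \<omega> $ i $ l + V (s + k) \<omega> $ l $ i)
          * (T s k \<omega> $ i $ j - T s k \<omega> $ l $ j)\<^sup>2"
        \<comment> \<open>As the row sums to one, the increment is a weighted average of differences
          to coordinate \<open>i\<close>. The variance inequality with both indices equal to
          \<open>i\<close> moves the square inside the average.\<close>
        have inc_le: "(T s (Suc k) \<omega> $ i $ j - T s k \<omega> $ i $ j)\<^sup>2 \<le> ?g k" for k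
        proof -
          have "T s (Suc k) \<omega> $ i $ j - T s k \<omega> $ i $ j
              = (\<Sum>l\<in>UNIV. V (s + k) \<omega> $ i $ l * (T s k \<omega> $ l $ j - T s k \<omega> $ i $ j))"
            unfolding T_Suc
            by (simp add: right_diff_distrib sum_subtractf sum_distrib_right[symmetric] entry_bounds(3)[OF \<omega>])
          then have "(T s (Suc k) \<omega> $ i $ j - T s k \<omega> $ i $ j)\<^sup>2
              \<le> (\<Sum>l\<in>UNIV. V (s + k) \<omega> $ i $ l * (T s k \<omega> $ l $ j - T s k \<omega> $ i $ j)\<^sup>2)"
            using convex_combination_variance[of "\<lambda>l. V (s + k) \<omega> $ i $ l"
                "\<lambda>l. T s k \<omega> $ l $ j - T s k \<omega> $ i $ j" i i] entry_bounds[OF \<omega>]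
            by simp
          also have "\<dots> \<le> ?g k"
          proof (rule sum_mono)
            fix l
            have "V (s + k) \<omega> $ i $ l * (T s k \<omega> $ i $ j - T s k \<omega> $ l $ j)\<^sup>2
                \<le> (V (s + k) \<omega> $ i $ l + V (s + k) \<omega> $ l $ i) * (T s k \<omega> $ i $ j - T s k \<omega> $ l $ j)\<^sup>2"
              by (intro mult_right_mono) (simp_all add: entry_bounds(1)[OF \<omega>])
            then show "V (s + k) \<omega> $ i $ l * (T s k \<omega> $ l $ j - T s k \<omega> $ i $ j)\<^sup>2
                \<le> (V (s + k) \<omega> $ i $ l + V (s + k) \<omega> $ l $ i) * (T s k \<omega> $ i $ j - T s k \<omega> $ l $ j)\<^sup>2"
              by (simp only: power2_commute[of "T s k \<omega> $ l $ j"])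
          qed
          finally show ?thesis .
        qed
        have g_lim: "?g \<longlonglongrightarrow> 0"
          using elim(2) by (intro tendsto_null_sum summable_LIMSEQ_zero) simp
        have "(\<lambda>k. (T s (Suc k) \<omega> $ i $ j - T s k \<omega> $ i $ j)\<^sup>2) \<longlonglongrightarrow> 0"
          by (rule tendsto_sandwich[OF _ _ tendsto_const g_lim]) (simp_all add: inc_le)
        from tendsto_real_sqrt[OF this]
        have "(\<lambda>k. \<bar>T s (Suc k) \<omega> $ i $ j - T s k \<omega> $ i $ j\<bar>) \<longlonglongrightarrow> 0"
          by (simp only: real_sqrt_abs real_sqrt_zero)
        then show ?thesis
          by (rule tendsto_rabs_zero_cancel)
      qed
      show ?case
      proof
        fix i
        show "convergent (\<lambda>k. T s k \<omega> $ i $ j)"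
        proof -
          \<comment> \<open>Column \<open>j\<close> of the products is packed into a vector to fit
            the deterministic criterion.\<close>
          have "convergent (\<lambda>k. (\<chi> i. T s k \<omega> $ i $ j) $ i)"
          proof (rule convergent_if_power_sums_converge[OF pos])
            show "\<bar>(\<chi> i. T s k \<omega> $ i $ j) $ i\<bar> \<le> 1" for k i
              using T_bounds[OF \<omega>, of s k i j] by simp
          qed (use elim(1) inc in simp_all)
          then show ?thesis by simp
        qed
      qed
    qed
  qed
  then have "AE \<omega> in M. \<forall>s j i. convergent (\<lambda>k. T s k \<omega> $ i $ j)"
    unfolding AE_all_countable by blast
  then show ?thesis
    unfolding stable_chain_def ergodic_index_iff_transition T_def by eventually_elim simp
qed

text \<open>The squared differences weighted by the flow are summable while the flow is not, and
  stability makes the differences converge; their limit can only be zero.\<close>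

lemma AE_mutually_weakly_ergodic:
  assumes "AE \<omega> in M. \<not> summable (\<lambda>k. V k \<omega> $ i $ j + V k \<omega> $ j $ i)"
  shows "AE \<omega> in M. mutually_weakly_ergodic (\<lambda>k. V k \<omega>) i j"
proof -
  have "AE \<omega> in M. \<forall>s l. summable (\<lambda>k. (V (s + k) \<omega> $ i $ j + V (s + k) \<omega> $ j $ i)
      * (T s k \<omega> $ i $ l - T s k \<omega> $ j $ l)\<^sup>2)"
    unfolding AE_all_countable by (intro allI eventually_all_finite AE_summable_flow)
  with assms AE_stable AE_space show ?thesis
  proof eventually_elim
    case (elim \<omega>)
    have "(\<lambda>k. T s k \<omega> $ i $ l - T s k \<omega> $ j $ l) \<longlonglongrightarrow> 0" for s l
    proof (rule tendsto_zero_if_summable_weighted_square)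
      show "summable (\<lambda>k. (V (s + k) \<omega> $ i $ j + V (s + k) \<omega> $ j $ i)
          * (T s k \<omega> $ i $ l - T s k \<omega> $ j $ l)\<^sup>2)"
        using elim by blast
      show "0 \<le> V (s + k) \<omega> $ i $ j + V (s + k) \<omega> $ j $ i" for k
        using elim by (intro add_nonneg_nonneg entry_bounds(1))
      show "\<not> summable (\<lambda>k. V (s + k) \<omega> $ i $ j + V (s + k) \<omega> $ j $ i)"
        using elim(1) summable_iff_shift[of "\<lambda>k. V k \<omega> $ i $ j + V k \<omega> $ j $ i" s]
        by (simp add: add.commute)
      show "convergent (\<lambda>k. T s k \<omega> $ i $ l - T s k \<omega> $ j $ l)"
        using elim(2) unfolding stable_chain_def ergodic_index_iff_transition T_def
        by (intro convergent_diff) simp_all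
    qed
    then show ?case
      unfolding mutually_weakly_ergodic_iff_transition T_def by blast
  qed
qed

end

section \<open>Stability and ergodic classes of the approximating chain\<close>

lemma independent_chain_if_independent_model:
  assumes "independent_model M W"
  shows "independent_chain M W"
  using assms
  unfolding independent_model_def random_model_def independent_chain_def independent_chain_axioms_def
  by blast

lemma steady_feedback_chain_if_model:
  assumes V: "independent_model M V" and pos: "\<forall>i. 0 < \<pi> $ i"
    and steady: "common_steady_state M V \<pi>" and feedback: "weak_feedback M V"
  obtains \<gamma> where "steady_feedback_chain M V \<pi> \<gamma>"
proof -
  interpret independent_chain M V
    by (rule independent_chain_if_independent_model[OF V])
  from feedback obtain \<gamma> where \<gamma>: "\<gamma> > 0" "\<And>k i j. i \<noteq> j \<Longrightarrow>
      \<gamma> * (expectation (\<lambda>\<omega>. V k \<omega> $ i $ j) + expectation (\<lambda>\<omega>. V k \<omega> $ j $ i))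
      \<le> expectation (\<lambda>\<omega>. column i (V k \<omega>) \<bullet> column j (V k \<omega>))"
    unfolding weak_feedback_def by blast
  have "expectation (\<lambda>\<omega>. column i (V k \<omega>) \<bullet> column j (V k \<omega>))
      = (\<Sum>l\<in>UNIV. expectation (\<lambda>\<omega>. V k \<omega> $ l $ i * V k \<omega> $ l $ j))" for k i j
  proof -
    have "integrable M (\<lambda>\<omega>. V k \<omega> $ l $ i * V k \<omega> $ l $ j)" for l
    proof (rule integrable_const_bound[of _ 1])
      show "AE \<omega> in M. norm (V k \<omega> $ l $ i * V k \<omega> $ l $ j) \<le> 1"
        using entry_bounds by (intro AE_I2) (simp add: mult_le_one)
    qed (intro borel_measurable_times entry_measurable)
    then show ?thesis
      by (simp add: inner_vec_def column_def)
  qed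
  moreover have "(\<Sum>i\<in>UNIV. \<pi> $ i * expectation (\<lambda>\<omega>. V k \<omega> $ i $ j)) = \<pi> $ j" for k j
  proof -
    have "(\<pi> v* expected_chain M V k) $ j = \<pi> $ j"
      using steady unfolding common_steady_state_def by simp
    then show ?thesis
      by (simp add: vector_matrix_mult_def expected_chain_nth mult.commute)
  qed
  ultimately have "steady_feedback_chain M V \<pi> \<gamma>"
    using pos \<gamma> by unfold_locales simp_all
  then show ?thesis by (rule that)
qed

theorem theorem6:
  fixes M :: "'a measure"
    and W V :: "nat \<Rightarrow> 'a \<Rightarrow> real ^ 'n ^ 'n"
    and \<pi> :: "real ^ 'n"
  assumes "independent_model M W"
    and "independent_model M V"
    and "l1_approximation M W V"
    and "\<forall>i. 0 < \<pi> $ i"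
    and "common_steady_state M V \<pi>"
    and "weak_feedback M V"
  shows "(AE \<omega> in M. stable_chain (\<lambda>k. W k \<omega>)) \<and>
    (\<forall>i j.
      ((AE \<omega> in M. mutually_ergodic (\<lambda>k. W k \<omega>) i j)
         \<longleftrightarrow> mutually_ergodic (expected_chain M W) i j) \<and>
      (mutually_ergodic (expected_chain M W) i j
         \<longleftrightarrow> same_connected_component (infinite_flow_graph M (\<lambda>k _. expected_chain M W k)) i j) \<and>
      (same_connected_component (infinite_flow_graph M (\<lambda>k _. expected_chain M W k)) i j
         \<longleftrightarrow> same_connected_component (infinite_flow_graph M W) i j))"
proof -
  obtain \<gamma> where "steady_feedback_chain M V \<pi> \<gamma>"
    using assms(2,4-6) by (rule steady_feedback_chain_if_model)
  then interpret V: steady_feedback_chain M V \<pi> \<gamma> .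
  interpret W: independent_chain M W
    by (rule independent_chain_if_independent_model[OF assms(1)])
  let ?GE = "infinite_flow_graph M (\<lambda>k _. expected_chain M W k)" and ?G = "infinite_flow_graph M W"
  have close: "AE \<omega> in M. \<forall>i j. summable (\<lambda>k. \<bar>V k \<omega> $ i $ j - W k \<omega> $ i $ j\<bar>)"
    using assms(3) unfolding l1_approximation_def by (intro eventually_all_finite) blast
  have stable: "AE \<omega> in M. stable_chain (\<lambda>k. W k \<omega>)"
    using V.AE_stable close AE_space
  proof eventually_elim
    case (elim \<omega>)
    then show ?case
      using stable_chain_perturbation[of "\<lambda>k. V k \<omega>" "\<lambda>k. W k \<omega>"] V.stochastic W.stochastic by blast
  qed
  have ab: "mutually_ergodic (expected_chain M W) i j"
    if "AE \<omega> in M. mutually_ergodic (\<lambda>k. W k \<omega>) i j" for i j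
    using that by (rule W.mutually_ergodic_expected_chain)
  have bc: "same_connected_component ?GE i j" if erg: "mutually_ergodic (expected_chain M W) i j" for i j
  proof (rule ccontr)
    assume "\<not> same_connected_component ?GE i j"
    \<comment> \<open>\<open>C\<close> collects the vertices reachable from \<open>i\<close> in the
      expected flow graph. No edge leaves it, so every pair across the cut has summable expected
      flow.\<close>
    define C where "C = {v. (\<lambda>x y. {x, y} \<in> ?GE)\<^sup>*\<^sup>* i v}"
    have "i \<in> C" "j \<notin> C"
      using \<open>\<not> same_connected_component ?GE i j\<close>
      unfolding C_def same_connected_component_iff_rtranclp by auto
    have "summable (\<lambda>k. expected_chain M W k $ u $ v + expected_chain M W k $ v $ u)"
      if "u \<in> C" "v \<notin> C" for u v
    proof -
      have "{u, v} \<notin> ?GE" "u \<noteq> v"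
        using that unfolding C_def by (auto intro: rtranclp.rtrancl_into_rtrancl)
      then show ?thesis
        unfolding W.infinite_flow_graph_expected_iff by blast
    qed
    then have "\<not> mutually_weakly_ergodic (expected_chain M W) i j"
      using W.stochastic_expected_chain \<open>i \<in> C\<close> \<open>j \<notin> C\<close>
      by (intro not_mutually_weakly_ergodic_of_summable_cut)
    with erg show False
      unfolding mutually_ergodic_def by blast
  qed
  have edges: "{i, j} \<in> ?GE \<longleftrightarrow> {i, j} \<in> ?G" for i j
    unfolding W.infinite_flow_graph_expected_iff W.infinite_flow_graph_iff W.AE_not_summable_flow_iff ..
  have cd: "same_connected_component ?GE i j \<longleftrightarrow> same_connected_component ?G i j" for i j
    unfolding same_connected_component_iff_rtranclp edges ..
  \<comment> \<open>The flows of \<open>V\<close> and \<open>W\<close> differ by a summable amount,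
    so divergence passes from \<open>W\<close> to \<open>V\<close>, where it forces weak ergodicity;
    the closeness of the chains carries this back to \<open>W\<close> pathwise.\<close>
  have edge_erg: "AE \<omega> in M. mutually_weakly_ergodic (\<lambda>k. W k \<omega>) i j" if "{i, j} \<in> ?G" for i j
  proof -
    have "AE \<omega> in M. \<not> summable (\<lambda>k. W k \<omega> $ i $ j + W k \<omega> $ j $ i)"
      using that unfolding W.infinite_flow_graph_iff by blast
    with close have "AE \<omega> in M. \<not> summable (\<lambda>k. V k \<omega> $ i $ j + V k \<omega> $ j $ i)"
    proof eventually_elim
      case (elim \<omega>)
      have "summable (\<lambda>k. V k \<omega> $ i $ j - W k \<omega> $ i $ j)" "summable (\<lambda>k. V k \<omega> $ j $ i - W k \<omega> $ j $ i)"
        using elim(1) by (blast intro: summable_rabs_cancel)+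
      then show ?case
        using elim(2) summable_diff[of "\<lambda>k. V k \<omega> $ i $ j + V k \<omega> $ j $ i"
            "\<lambda>k. (V k \<omega> $ i $ j - W k \<omega> $ i $ j) + (V k \<omega> $ j $ i - W k \<omega> $ j $ i)"]
        by (auto simp: summable_add)
    qed
    then have "AE \<omega> in M. mutually_weakly_ergodic (\<lambda>k. V k \<omega>) i j"
      by (rule V.AE_mutually_weakly_ergodic)
    then show ?thesis
      using close AE_space
    proof eventually_elim
      case (elim \<omega>)
      then show ?case
        using mutually_weakly_ergodic_perturbation[of "\<lambda>k. V k \<omega>" "\<lambda>k. W k \<omega>"]
          V.stochastic W.stochastic by blast
    qed
  qed
  \<comment> \<open>Weak ergodicity is transitive and spreads from edges along paths; almost sure
    stability supplies the existence of the limits.\<close>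
  have da: "AE \<omega> in M. mutually_ergodic (\<lambda>k. W k \<omega>) i j" if "same_connected_component ?G i j" for i j
  proof -
    from that have "(\<lambda>x y. {x, y} \<in> ?G)\<^sup>*\<^sup>* i j"
      unfolding same_connected_component_iff_rtranclp .
    then have "AE \<omega> in M. mutually_weakly_ergodic (\<lambda>k. W k \<omega>) i j"
    proof induction
      case base
      then show ?case by (simp add: mutually_weakly_ergodic_def)
    next
      case (step y z)
      from step(3) edge_erg[OF step(2)] show ?case
        by eventually_elim (rule mutually_weakly_ergodic_trans)
    qed
    with stable show ?thesis
      unfolding mutually_ergodic_def stable_chain_def by eventually_elim blast
  qed
  \<comment> \<open>The facts \<open>ab\<close>, \<open>bc\<close>, \<open>cd\<close> and
    \<open>da\<close> close a cycle of implications.\<close>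
  show ?thesis
  proof (intro conjI allI)
    fix i j
    show "(AE \<omega> in M. mutually_ergodic (\<lambda>k. W k \<omega>) i j) \<longleftrightarrow> mutually_ergodic (expected_chain M W) i j"
      using ab[of i j] bc[of i j] cd[of i j] da[of i j] by argo
    show "mutually_ergodic (expected_chain M W) i j \<longleftrightarrow> same_connected_component ?GE i j"
      using ab[of i j] bc[of i j] cd[of i j] da[of i j] by argo
  qed (use stable cd in auto)
qed

end
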